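(* Let $n\ge 1$, let $\lambda\vdash n$ be a partition, and let $k$ be an integer. If $b(\lambda)\le k\le \binom{n}{2}-b(\lambda')$, then $b_{\lambda,k}>0$, except in the case when $\lambda$ is a rectangle with at least two rows and at least two columns and $k$ is either $b(\lambda)+1$ or $\binom{n}{2}-b(\lambda')-1$. Furthermore, $b_{\lambda,k}=0$ for $k<b(\lambda)$ or $k>\binom{n}{2}-b(\lambda')$.
   Context: Partitions $\lambda=(\lambda_1\ge\lambda_2\ge\cdots)$ of $n$ are drawn as diagrams in English notation (row 1 on top, rows left-justified). $\mathrm{SYT}(\lambda)$ is the set of standard Young tableaux of shape $\lambda$, i.e. bijective fillings of the cells of the diagram with $1,\dots,n$ that increase along rows (left to right) and down columns. An integer $i\in\{1,\dots,n-1\}$ is a descent of $T\in\mathrm{SYT}(\lambda)$ if $i+1$ appears in a strictly lower row of $T$ than $i$. The major index $\mathrm{maj}(T)$ is the sum of the descents of $T$. Set $b_{\lambda,k}:=\#\{T\in\mathrm{SYT}(\lambda):\mathrm{maj}(T)=k\}$, which for integers $k<0$ is $0$. Write $b(\lambda):=\sum_{i\ge1}(i-1)\lambda_i$ and let $\lambda'$ denote the conjugate partition of $\lambda$. The exception clause means that $b_{\lambda,k}=0$ in the stated exceptional cases. *)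

theory Defs
  imports "HOL-Library.FuncSet"
begin

text \<open>
  A partition is the list of its nonzero parts in weakly decreasing order. Rows and columns are
  numbered from 0, with row 0 on top, so ``strictly lower'' means a strictly larger row index.
\<close>

definition partition_of :: "nat \<Rightarrow> nat list \<Rightarrow> bool" where
  "partition_of n la \<longleftrightarrow> sorted_wrt (\<ge>) la \<and> 0 \<notin> set la \<and> sum_list la = n"

definition cells :: "nat list \<Rightarrow> (nat \<times> nat) set" where
  "cells la = {(r, c). r < length la \<and> c < la ! r}"

text \<open>The condition \<open>T \<in> extensional (cells la)\<close> fixes the values of \<open>T\<close> outside the diagram, so
  that distinct elements of \<open>SYT la\<close> are distinct fillings and cardinalities are the right ones.\<close>

definition SYT :: "nat list \<Rightarrow> (nat \<times> nat \<Rightarrow> nat) set" where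
  "SYT la = {T \<in> extensional (cells la).
     bij_betw T (cells la) {1..sum_list la} \<and>
     (\<forall>r c c'. (r, c) \<in> cells la \<and> (r, c') \<in> cells la \<and> c < c' \<longrightarrow> T (r, c) < T (r, c')) \<and>
     (\<forall>r r' c. (r, c) \<in> cells la \<and> (r', c) \<in> cells la \<and> r < r' \<longrightarrow> T (r, c) < T (r', c))}"

definition descents :: "nat list \<Rightarrow> (nat \<times> nat \<Rightarrow> nat) \<Rightarrow> nat set" where
  "descents la T = {i. 1 \<le> i \<and> i < sum_list la \<and>
     (\<exists>r c r' c'. (r, c) \<in> cells la \<and> (r', c') \<in> cells la \<and>
        T (r, c) = i \<and> T (r', c') = i + 1 \<and> r < r')}"

definition maj :: "nat list \<Rightarrow> (nat \<times> nat \<Rightarrow> nat) \<Rightarrow> nat" where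
  "maj la T = \<Sum> (descents la T)"

definition maj_count :: "nat list \<Rightarrow> int \<Rightarrow> nat" where
  "maj_count la k = card {T \<in> SYT la. int (maj la T) = k}"

text \<open>The usual \<open>\<Sum>i\<ge>1. (i - 1) * la\<^sub>i\<close>, with the index shifted to start at 0.\<close>

definition b_stat :: "nat list \<Rightarrow> nat" where
  "b_stat la = (\<Sum>i<length la. i * la ! i)"

definition conjugate :: "nat list \<Rightarrow> nat list" where
  "conjugate la = map (\<lambda>c. card {r. r < length la \<and> c < la ! r})
     [0..<(case la of [] \<Rightarrow> 0 | p # _ \<Rightarrow> p)]"

definition proper_rectangle :: "nat list \<Rightarrow> bool" where
  "proper_rectangle la \<longleftrightarrow> (\<exists>p q. 2 \<le> p \<and> 2 \<le> q \<and> la = replicate p q)"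

end

theory Submission
  imports Defs
begin

text \<open>
  The idea is to prove more: to determine the values of the major index for each position \<open>(r, c)\<close>
  of the largest entry. Deleting that entry leaves a tableau of a smaller diagram \<open>Y\<close>, whose
  largest entry sits in a corner \<open>(a, b)\<close> of \<open>Y\<close>; the major index drops by \<open>card Y\<close> if
  \<open>a < r\<close>, and stays the same otherwise. So the set of values for \<open>(r, c)\<close> is a union of sets
  for corners of \<open>Y\<close>, some of them shifted. The predicate \<open>reach\<close> describes this recursion,
  with \<open>\<Sum>(i, j)\<in>Y. i\<close> subtracted from the major index, so that the smallest value is \<open>0\<close>.

  Let \<open>offpairs Y\<close> be the number of pairs of cells in different rows and columns; it equals
  \<open>n choose 2\<close> minus the two \<open>b\<close>-statistics, the width of the range in the theorem. Then the
  values for a corner lie between the number \<open>ne\<close> of cells strictly north-east of it and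
  \<open>offpairs Y\<close> minus the number \<open>sw\<close> of cells strictly south-west of it (\<open>reach_ge\<close>,
  \<open>reach_le\<close>). All of them are attained except, at certain corners, the number next to the lower
  bound or next to the upper bound (\<open>diagram_filled\<close>). These exceptions, \<open>low_gap\<close> and
  \<open>high_gap\<close>, occur only in rectangles and in shapes that differ from a rectangle by one row or
  one column.

  Keeping track of the corner makes an induction possible. The intervals for any two corners of \<open>Y\<close> overlap or are
  adjacent, since \<open>ne\<close> at the one plus \<open>sw\<close> at the other is at most \<open>offpairs Y + 1\<close>
  (\<open>ne_add_sw_le\<close>), and the unshifted values meet the shifted ones because
  \<open>card Y \<le> offpairs Y + 1\<close> for all but the near-rectangular shapes (\<open>card_le_offpairs\<close>). The
  ends of the union are the ends of the interval for \<open>(r, c)\<close> (\<open>covered_generic\<close>). For the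
  near-rectangular shapes, which have at most two corners, everything is explicit and amounts to
  arithmetic (\<open>covered_rect_row\<close>). Transposition, which replaces a value \<open>j\<close> by
  \<open>offpairs Y - j\<close> (\<open>reach_converse\<close>), halves the number of cases.

  Taking all corners together fills the whole range (\<open>filled_reach\<close>), except that in a rectangle
  with at least two rows and columns the gaps of the only corner remain (\<open>reach_rect_row_gap\<close>).
\<close>

section \<open>Diagrams and their corners\<close>

definition diagram :: "(nat \<times> nat) set \<Rightarrow> bool" where
  "diagram Y \<longleftrightarrow> finite Y \<and> (\<forall>i j i' j'. (i, j) \<in> Y \<longrightarrow> i' \<le> i \<longrightarrow> j' \<le> j \<longrightarrow> (i', j') \<in> Y)"

definition corner :: "(nat \<times> nat) set \<Rightarrow> nat \<Rightarrow> nat \<Rightarrow> bool" where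
  "corner Y r c \<longleftrightarrow> (r, c) \<in> Y \<and> (Suc r, c) \<notin> Y \<and> (r, Suc c) \<notin> Y"

definition addable :: "(nat \<times> nat) set \<Rightarrow> nat \<Rightarrow> nat \<Rightarrow> bool" where
  "addable Y r c \<longleftrightarrow> diagram Y \<and> (r, c) \<notin> Y \<and> diagram (insert (r, c) Y)"

lemma diagramD: "diagram Y \<Longrightarrow> (i, j) \<in> Y \<Longrightarrow> i' \<le> i \<Longrightarrow> j' \<le> j \<Longrightarrow> (i', j') \<in> Y"
  unfolding diagram_def by blast

lemma diagram_finite [simp]: "diagram Y \<Longrightarrow> finite Y"
  unfolding diagram_def by blast

lemma diagram_converse [simp]: "diagram (Y\<inverse>) \<longleftrightarrow> diagram Y"
  unfolding diagram_def by auto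

lemma corner_converse [simp]: "corner (Y\<inverse>) c r \<longleftrightarrow> corner Y r c"
  unfolding corner_def by auto

lemma converse_insert_pair: "(insert (r, c) Y)\<inverse> = insert (c, r) (Y\<inverse>)"
  by auto

lemma addable_converse [simp]: "addable (Y\<inverse>) c r \<longleftrightarrow> addable Y r c"
  unfolding addable_def by (simp flip: converse_insert_pair)

lemma card_converse [simp]: "card (Y\<inverse>) = card Y"
proof -
  have "Y\<inverse> = prod.swap ` Y" by auto
  thus ?thesis by (simp add: card_image)
qed

lemma corner_addable:
  assumes "diagram Y" "corner Y r c"
  shows "addable (Y - {(r, c)}) r c"
proof -
  have "diagram (Y - {(r, c)})"
    unfolding diagram_def
  proof (intro conjI allI impI)
    show "finite (Y - {(r, c)})" using assms by simp
    fix i j i' j'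
    assume ij: "(i, j) \<in> Y - {(r, c)}" "i' \<le> i" "j' \<le> j"
    hence "(i', j') \<in> Y" using assms(1) diagramD by blast
    moreover have "(i', j') \<noteq> (r, c)"
    proof
      assume "(i', j') = (r, c)"
      hence "Suc r \<le> i \<and> c \<le> j \<or> r \<le> i \<and> Suc c \<le> j" using ij by auto
      thus False using assms ij(1) unfolding corner_def by (metis DiffD1 diagramD)
    qed
    ultimately show "(i', j') \<in> Y - {(r, c)}" by simp
  qed
  moreover have "insert (r, c) (Y - {(r, c)}) = Y" using assms unfolding corner_def by auto
  ultimately show ?thesis using assms unfolding addable_def by simp
qed

lemma addable_corner: "addable Y r c \<Longrightarrow> corner (insert (r, c) Y) r c"
  unfolding addable_def corner_def using diagramD[of Y] by fastforce

lemma addable_le: "addable Y r c \<Longrightarrow> i \<le> r \<Longrightarrow> j \<le> c \<Longrightarrow> (i, j) \<noteq> (r, c) \<Longrightarrow> (i, j) \<in> Y"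
  unfolding addable_def using diagramD[of "insert (r, c) Y" r c i j] by blast

lemma addable_ge: "addable Y r c \<Longrightarrow> r \<le> i \<Longrightarrow> c \<le> j \<Longrightarrow> (i, j) \<notin> Y"
  unfolding addable_def using diagramD[of Y i j r c] by blast

lemma addable_finite [simp]: "addable Y r c \<Longrightarrow> finite Y"
  unfolding addable_def by simp

lemma corner_vs_addable:
  assumes "addable Y r c" "corner Y a b"
  shows "a < r \<and> c \<le> b \<or> r \<le> a \<and> b < c"
proof -
  have "\<not> (r \<le> a \<and> c \<le> b)" using assms addable_ge unfolding corner_def by blast
  moreover have "\<not> (a < r \<and> b < c)"
    using assms addable_le[OF assms(1), of "Suc a" b] unfolding corner_def by auto
  ultimately show ?thesis by linarith
qed

lemma ex_corner_lowest:
  assumes "diagram Y" "Y \<noteq> {}"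
  obtains a b where "corner Y a b" "\<And>i j. (i, j) \<in> Y \<Longrightarrow> i \<le> a"
proof -
  define a where "a = Max (fst ` Y)"
  have fin: "finite (fst ` Y)" "fst ` Y \<noteq> {}" using assms by auto
  have "a \<in> fst ` Y" unfolding a_def using fin by (rule Max_in)
  then obtain j where j: "(a, j) \<in> Y" by auto
  have le: "i \<le> a" if "(i, j) \<in> Y" for i j
    unfolding a_def using fin(1) that by (intro Max_ge) (auto intro: rev_image_eqI)
  define R where "R = {j. (a, j) \<in> Y}"
  have "R \<subseteq> snd ` Y" unfolding R_def by force
  hence finR: "finite R" using assms by (meson diagram_finite finite_imageI finite_subset)
  have "Max R \<in> R" using finR j unfolding R_def by (intro Max_in) auto
  moreover have "Suc (Max R) \<notin> R" using Max_ge[OF finR] by (metis Suc_n_not_le_n)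
  ultimately have "corner Y a (Max R)"
    unfolding corner_def R_def using le[of "Suc a"] by force
  thus ?thesis using that le by blast
qed

text \<open>
  A diagram is built up cell by cell: undoing the additions means deleting corners.
\<close>
lemma diagram_induct [consumes 1, case_names empty add]:
  assumes "diagram Y" "P {}"
    "\<And>Y r c. addable Y r c \<Longrightarrow> P Y \<Longrightarrow> P (insert (r, c) Y)"
  shows "P Y"
  using assms(1)
proof (induction "card Y" arbitrary: Y)
  case 0
  thus ?case using assms(2) by simp
next
  case (Suc n)
  hence "Y \<noteq> {}" by auto
  then obtain r c where rc: "corner Y r c" using ex_corner_lowest Suc.prems by metis
  hence add: "addable (Y - {(r, c)}) r c" using corner_addable Suc.prems by blast
  have mem: "(r, c) \<in> Y" using rc unfolding corner_def by simp
  have "P (Y - {(r, c)})"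
    using Suc.hyps(1)[of "Y - {(r, c)}"] Suc.hyps(2) Suc.prems mem add
    unfolding addable_def by simp
  from assms(3)[OF add this] mem show ?case by (simp add: insert_absorb)
qed

section \<open>Cells and pairs of cells in general position\<close>

text \<open>
  Cells strictly above and strictly to the right of a given cell; \<open>sw\<close> is the mirror image.
  For a corner, these two numbers are the distances of the smallest and of the largest major index
  with the largest entry in that corner from the extremes over all tableaux.
\<close>
definition ne :: "(nat \<times> nat) set \<Rightarrow> nat \<Rightarrow> nat \<Rightarrow> nat" where
  "ne Y r c = card {(i, j). (i, j) \<in> Y \<and> i < r \<and> c < j}"

definition sw :: "(nat \<times> nat) set \<Rightarrow> nat \<Rightarrow> nat \<Rightarrow> nat" where
  "sw Y r c = card {(i, j). (i, j) \<in> Y \<and> r < i \<and> j < c}"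

lemma ne_converse [simp]: "ne (Y\<inverse>) c r = sw Y r c"
proof -
  have "{(i, j). (i, j) \<in> Y\<inverse> \<and> i < c \<and> r < j} = {(i, j). (i, j) \<in> Y \<and> r < i \<and> j < c}\<inverse>"
    by auto
  thus ?thesis unfolding ne_def sw_def by simp
qed

lemma sw_converse [simp]: "sw (Y\<inverse>) c r = ne Y r c"
  using ne_converse[of "Y\<inverse>" r c] by simp

text \<open>
  The number of unordered pairs of cells in different rows and different columns. It is the width
  of the whole range of major indices, see \<open>choose_two_eq\<close>; being a number of pairs, it can be
  bounded from below by exhibiting pairs.
\<close>
definition offpairs :: "(nat \<times> nat) set \<Rightarrow> nat" where
  "offpairs Y = card {((i, j), (i', j')). (i, j) \<in> Y \<and> (i', j') \<in> Y \<and> i < i' \<and> j \<noteq> j'}"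

lemma offpairs_eq_0:
  assumes "\<And>i j i' j'. (i, j) \<in> Y \<Longrightarrow> (i', j') \<in> Y \<Longrightarrow> i < i' \<Longrightarrow> j = j'"
  shows "offpairs Y = 0"
proof -
  have "{((i, j), (i', j')). (i, j) \<in> Y \<and> (i', j') \<in> Y \<and> i < i' \<and> j \<noteq> j'} = {}"
    using assms by blast
  thus ?thesis unfolding offpairs_def by (simp only: card.empty)
qed

lemma finite_offpairs: "finite Y \<Longrightarrow>
   finite {((i, j), (i', j')). (i, j) \<in> Y \<and> (i', j') \<in> Y \<and> i < i' \<and> j \<noteq> j'}"
  by (rule finite_subset[of _ "Y \<times> Y"]) auto

lemma ne_insert:
  assumes "addable Y r c"
  shows "ne (insert (r, c) Y) r c + r = card {(i, j). (i, j) \<in> Y \<and> i < r \<and> c \<le> j}"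
proof -
  let ?A = "{(i, j). (i, j) \<in> Y \<and> i < r \<and> c < j}"
  have "{(i, j). (i, j) \<in> Y \<and> i < r \<and> c \<le> j} = ?A \<union> {..<r} \<times> {c}"
    using addable_le[OF assms] by (auto simp: order_le_less)
  moreover have "finite ?A" using assms by (auto intro: finite_subset[of _ Y])
  moreover have "?A \<inter> ({..<r} \<times> {c}) = {}" by auto
  ultimately have "card {(i, j). (i, j) \<in> Y \<and> i < r \<and> c \<le> j} = card ?A + r"
    by (simp add: card_Un_disjoint)
  moreover have "{(i, j). (i, j) \<in> insert (r, c) Y \<and> i < r \<and> c < j} = ?A" by auto
  ultimately show ?thesis unfolding ne_def by simp
qed

lemma sw_insert:
  assumes "addable Y r c"
  shows "sw (insert (r, c) Y) r c + c = card {(i, j). (i, j) \<in> Y \<and> r \<le> i \<and> j < c}"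
proof -
  have "sw (insert (r, c) Y) r c + c = card {(i, j). (i, j) \<in> Y\<inverse> \<and> i < c \<and> r \<le> j}"
    using ne_insert[of "Y\<inverse>" c r] assms by (simp flip: converse_insert_pair)
  also have "{(i, j). (i, j) \<in> Y\<inverse> \<and> i < c \<and> r \<le> j} = {(i, j). (i, j) \<in> Y \<and> r \<le> i \<and> j < c}\<inverse>"
    by auto
  finally show ?thesis by simp
qed

text \<open>
  A new corner in position \<open>(r, c)\<close> shares its row with \<open>c\<close> old cells and its column with
  \<open>r\<close> old cells, and pairs up with all the others.
\<close>
lemma offpairs_insert:
  assumes "addable Y r c"
  shows "offpairs (insert (r, c) Y) + r + c = offpairs Y + card Y"
proof -
  let ?P = "\<lambda>Y. {((i, j), (i', j')). (i, j) \<in> Y \<and> (i', j') \<in> Y \<and> i < (i'::nat) \<and> j \<noteq> (j'::nat)}"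
  let ?L = "{(i, j). (i, j) \<in> Y \<and> r < i}"
  let ?U = "{(i, j). (i, j) \<in> Y \<and> i < r \<and> j \<noteq> c}"
  let ?R = "{r} \<times> {..<c}" and ?C = "{..<r} \<times> {c}"
  have notin: "(r, c) \<notin> Y" using assms unfolding addable_def by simp
  have fin: "finite Y" using assms by simp
  have fL: "finite ?L" "finite ?U" using fin by (auto intro: finite_subset[of _ Y])
  have fP: "finite (?P Y)" using fin by (rule finite_offpairs)
  have L: "j < c" if "(i, j) \<in> Y" "r \<le> i" for i j
    using that addable_ge[OF assms, of i j] by force
  define X where "X = Pair (r, c) ` ?L"
  define V where "V = (\<lambda>x. (x, (r, c))) ` ?U"
  have X: "((i, j), (i', j')) \<in> X \<longleftrightarrow> i = r \<and> j = c \<and> (i', j') \<in> Y \<and> r < i'"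
    and V: "((i, j), (i', j')) \<in> V \<longleftrightarrow> i' = r \<and> j' = c \<and> (i, j) \<in> Y \<and> i < r \<and> j \<noteq> c"
    for i j i' j'
    unfolding X_def V_def by auto
  have cXV: "card X = card ?L" "card V = card ?U" "finite X" "finite V"
    unfolding X_def V_def using fL by (auto simp: card_image inj_on_def)
  have K: "\<not> ((i, j) \<in> Y \<and> r < i \<and> j = c)" for i j
    using L[of i j] by auto
  have mem: "((i, j), (i', j')) \<in> ?P (insert (r, c) Y) \<longleftrightarrow>
      ((i, j), (i', j')) \<in> ?P Y \<union> (X \<union> V)" for i j i' j'
    unfolding Un_iff X V mem_Collect_eq case_prod_conv insert_iff prod.inject
    using K[of i' j'] notin by (cases "i = r \<and> j = c"; cases "i' = r \<and> j' = c") blast+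
  have "?P (insert (r, c) Y) = ?P Y \<union> (X \<union> V)"
  proof (rule set_eqI)
    fix x :: "(nat \<times> nat) \<times> nat \<times> nat"
    obtain i j i' j' where x: "x = ((i, j), (i', j'))" by (metis surj_pair)
    show "x \<in> ?P (insert (r, c) Y) \<longleftrightarrow> x \<in> ?P Y \<union> (X \<union> V)"
      unfolding x by (rule mem)
  qed
  moreover have "?P Y \<inter> (X \<union> V) = {}" "X \<inter> V = {}"
    unfolding X_def V_def using notin by blast+
  ultimately have "card (?P (insert (r, c) Y)) = card (?P Y) + (card ?L + card ?U)"
    using card_Un_disjoint[OF fP, of "X \<union> V"] card_Un_disjoint[of X V] cXV by simp
  moreover have "x \<in> Y \<longleftrightarrow> x \<in> (?L \<union> ?U) \<union> (?R \<union> ?C)" for x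
  proof -
    obtain i j where x: "x = (i, j)" by fastforce
    show ?thesis using addable_le[OF assms, of i j] L[of i j] unfolding x
      by (cases i r rule: linorder_cases) auto
  qed
  hence "Y = (?L \<union> ?U) \<union> (?R \<union> ?C)" by blast
  hence "card Y = card ((?L \<union> ?U) \<union> (?R \<union> ?C))" by (rule arg_cong)
  moreover have "(?L \<union> ?U) \<inter> (?R \<union> ?C) = {}" using L by auto
  hence "card ((?L \<union> ?U) \<union> (?R \<union> ?C)) = card (?L \<union> ?U) + card (?R \<union> ?C)"
    using fL by (intro card_Un_disjoint) auto
  moreover have "card (?L \<union> ?U) = card ?L + card ?U"
    using fL by (intro card_Un_disjoint) auto
  moreover have "card (?R \<union> ?C) = c + r"
    by (subst card_Un_disjoint) auto
  ultimately show ?thesis unfolding offpairs_def by linarith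
qed

text \<open>
  A pair of distinct cells lies in one row, or in one column, or is counted by \<open>offpairs\<close>; the
  column indices sum up to the number of pairs in a row, the row indices to the number of pairs in
  a column.
\<close>
lemma choose_two_eq:
  assumes "diagram Y"
  shows "card Y choose 2 = offpairs Y + (\<Sum>(i, j)\<in>Y. i) + (\<Sum>(i, j)\<in>Y. j)"
  using assms
proof (induction rule: diagram_induct)
  case empty
  have "offpairs {} = 0" by (rule offpairs_eq_0) auto
  thus ?case by (simp add: numeral_2_eq_2)
next
  case (add Y r c)
  have "(r, c) \<notin> Y" "finite Y" using add.hyps by (auto simp: addable_def)
  moreover have "Suc (card Y) choose 2 = card Y + (card Y choose 2)"
    by (simp add: numeral_2_eq_2)
  ultimately show ?case using add.IH offpairs_insert[OF add.hyps] by simp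
qed

lemma sum_converse: "(\<Sum>(i, j)\<in>Y\<inverse>. f i j) = (\<Sum>(i, j)\<in>Y. f j i)"
  by (rule sum.reindex_bij_witness[of _ prod.swap prod.swap]) auto

lemma offpairs_converse [simp]: "diagram Y \<Longrightarrow> offpairs (Y\<inverse>) = offpairs Y"
  using choose_two_eq[of Y] choose_two_eq[of "Y\<inverse>"]
  by (simp add: sum_converse[of "\<lambda>i j. i"] sum_converse[of "\<lambda>i j. j"])

text \<open>
  The reason why the intervals of values belonging to two different corners leave no hole between
  them: the pairs of one corner with the cells north-east of it and the pairs of the other one with
  the cells south-west of it are all counted by \<open>offpairs\<close>, and the two kinds have at most one pair
  in common.
\<close>
lemma ne_add_sw_le:
  assumes "finite Y" "(a, b) \<in> Y" "(a', b') \<in> Y"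
  shows "ne Y a b + sw Y a' b' \<le> offpairs Y + 1"
proof -
  let ?N = "{(i, j). (i, j) \<in> Y \<and> i < a \<and> b < j}"
  let ?S = "{(i, j). (i, j) \<in> Y \<and> a' < i \<and> j < b'}"
  let ?X = "(\<lambda>x. (x, (a, b))) ` ?N" and ?Z = "Pair (a', b') ` ?S"
  have fin: "finite ?N" "finite ?S" using assms by (auto intro: finite_subset[of _ Y])
  \<comment> \<open>a common pair has its upper cell in \<open>(a', b')\<close> and its lower cell in \<open>(a, b)\<close>\<close>
  have "?X \<inter> ?Z \<subseteq> {((a', b'), (a, b))}" by auto
  hence "card (?X \<inter> ?Z) \<le> 1" using card_mono[of "{((a', b'), (a, b))}"] by simp
  moreover have "card (?X \<union> ?Z) \<le> offpairs Y"
    unfolding offpairs_def using assms by (intro card_mono finite_offpairs) auto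
  moreover have "card ?X + card ?Z = card (?X \<union> ?Z) + card (?X \<inter> ?Z)"
    using fin by (intro card_Un_Int) auto
  moreover have "card ?X = ne Y a b" "card ?Z = sw Y a' b'"
    unfolding ne_def sw_def by (auto simp: card_image inj_on_def)
  ultimately show ?thesis by linarith
qed

section \<open>Values of the major index, by position of the largest entry\<close>

text \<open>
  \<open>reach Y r c j\<close> says that some standard tableau of shape \<open>Y\<close> has its largest entry in
  \<open>(r, c)\<close> and major index \<open>j\<close> more than the sum of the row indices of \<open>Y\<close> (lemmas
  \<open>reach_standard\<close> and \<open>standard_reach\<close>). Adding a new largest entry in row \<open>r\<close>
  makes the old one, in row \<open>a\<close>, a descent iff \<open>a < r\<close>; subtracting \<open>r\<close> keeps the
  normalisation.
\<close>
inductive reach :: "(nat \<times> nat) set \<Rightarrow> nat \<Rightarrow> nat \<Rightarrow> int \<Rightarrow> bool" where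
  single: "reach {(0, 0)} 0 0 0"
| add: "reach Y a b j \<Longrightarrow> addable Y r c \<Longrightarrow>
    reach (insert (r, c) Y) r c (j + (if a < r then int (card Y) else 0) - int r)"

lemma diagram_single: "diagram {(0, 0)}"
  unfolding diagram_def by auto

lemma reach_corner: "reach Y r c j \<Longrightarrow> diagram Y \<and> corner Y r c"
proof (induction rule: reach.induct)
  case single
  show ?case by (simp add: diagram_single corner_def)
next
  case (add Y a b j r c)
  thus ?case using addable_corner unfolding addable_def by blast
qed

text \<open>
  Transposing a tableau complements its descent set, because the next entry lies either in a lower
  row or further to the right, but not both.
\<close>
lemma reach_converse:
  "reach Y r c j \<Longrightarrow> reach (Y\<inverse>) c r (int (offpairs Y) - j)"
proof (induction rule: reach.induct)
  case single
  have "offpairs {(0, 0)} = 0" by (rule offpairs_eq_0) auto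
  moreover have "{(0::nat, 0::nat)}\<inverse> = {(0, 0)}" by auto
  ultimately show ?case using reach.single by simp
next
  case (add Y a b j r c)
  have "corner Y a b" using reach_corner add.hyps(1) by blast
  with corner_vs_addable[OF add.hyps(2)] have "b < c \<longleftrightarrow> \<not> a < r" by fastforce
  moreover have "int (offpairs (insert (r, c) Y)) + int r + int c = int (offpairs Y) + int (card Y)"
    using offpairs_insert[OF add.hyps(2)] by linarith
  ultimately have eq: "int (offpairs (insert (r, c) Y)) - (j + (if a < r then int (card Y) else 0) - int r)
      = int (offpairs Y) - j + (if b < c then int (card Y) else 0) - int c"
    by auto
  have "addable (Y\<inverse>) c r" using add.hyps by simp
  from reach.add[OF add.IH this] show ?case
    unfolding converse_insert_pair card_converse eq .
qed

text \<open>
  The cells north-east of the new corner, together with the \<open>r\<close> cells above it, are north-east of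
  the previous corner if that one lies further down; if it lies above, then the new descent is worth
  at least that many cells.
\<close>
lemma reach_ge: "reach Y r c j \<Longrightarrow> int (ne Y r c) \<le> j"
proof (induction rule: reach.induct)
  case single
  have "{(i, j). (i, j) \<in> {(0::nat, 0::nat)} \<and> i < 0 \<and> 0 < j} = {}" by auto
  thus ?case by (simp add: ne_def)
next
  case (add Y a b j r c)
  let ?S = "{(i, j). (i, j) \<in> Y \<and> i < r \<and> c \<le> j}"
  have fin: "finite Y" using add.hyps by simp
  have "card ?S \<le> card Y" using fin by (intro card_mono) auto
  moreover have "card ?S \<le> ne Y a b" if "\<not> a < r"
  proof -
    have "corner Y a b" using reach_corner add.hyps(1) by blast
    with corner_vs_addable[OF add.hyps(2)] that have "b < c" by fastforce
    thus ?thesis unfolding ne_def using fin that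
      by (intro card_mono) (auto intro: finite_subset[of _ Y])
  qed
  ultimately show ?case using add.IH ne_insert[OF add.hyps(2)] by (auto split: if_splits)
qed

lemma reach_le: "reach Y r c j \<Longrightarrow> j \<le> int (offpairs Y) - int (sw Y r c)"
  using reach_ge[OF reach_converse[of Y r c j]] by simp

section \<open>Rectangles with one further row\<close>

text \<open>
  The shape \<open>rect_row p q q\<close> is a rectangle with \<open>p + 1\<close> rows; letting the last row grow from
  \<open>0\<close> to \<open>q\<close> leads from one rectangle to the next.
\<close>
definition rect_row :: "nat \<Rightarrow> nat \<Rightarrow> nat \<Rightarrow> (nat \<times> nat) set" where
  "rect_row p q d = {(i, j). i < p \<and> j < q \<or> i = p \<and> j < d}"

lemma rect_row_iff [simp]: "(i, j) \<in> rect_row p q d \<longleftrightarrow> i < p \<and> j < q \<or> i = p \<and> j < d"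
  unfolding rect_row_def by simp

lemma rect_row_Un: "rect_row p q d = {..<p} \<times> {..<q} \<union> {p} \<times> {..<d}"
  unfolding rect_row_def by auto

lemma rect_row_full: "rect_row (Suc p) q 0 = rect_row p q q"
  unfolding rect_row_def by auto

lemma diagram_rect_row: "d \<le> q \<Longrightarrow> diagram (rect_row p q d)"
  unfolding diagram_def by (auto simp: rect_row_Un)

lemma insert_rect_row: "insert (p, d) (rect_row p q d) = rect_row p q (Suc d)"
  unfolding rect_row_def by auto

lemma addable_rect_row: "d < q \<Longrightarrow> addable (rect_row p q d) p d"
  unfolding addable_def insert_rect_row by (simp add: diagram_rect_row)

lemma card_rect_row: "card (rect_row p q d) = p * q + d"
  unfolding rect_row_Un by (subst card_Un_disjoint) auto

lemma offpairs_rect_row: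
  assumes "d \<le> q"
  shows "2 * offpairs (rect_row p q d) = p * (p - 1) * q * (q - 1) + 2 * p * d * (q - 1)"
  using assms
proof (induction p arbitrary: d)
  case 0
  have "offpairs (rect_row 0 q d) = 0" by (rule offpairs_eq_0) auto
  thus ?case by simp
next
  case (Suc p)
  show ?case using Suc.prems
  proof (induction d)
    case 0
    show ?case using Suc.IH[of q] unfolding rect_row_full
      by (cases p; cases q) (simp_all add: algebra_simps)
  next
    case (Suc d)
    have "offpairs (rect_row (Suc p) q (Suc d)) + Suc p + d
        = offpairs (rect_row (Suc p) q d) + (Suc p * q + d)"
      using offpairs_insert[OF addable_rect_row[of d q "Suc p"]] Suc.prems
      unfolding insert_rect_row card_rect_row by simp
    moreover obtain q' where "q = Suc q'" using Suc.prems by (cases q) auto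
    ultimately show ?case using Suc.IH Suc.prems by (simp add: algebra_simps)
  qed
qed

lemma corner_rect_row:
  assumes "corner (rect_row p q d) a b" "1 \<le> d" "d \<le> q"
  shows "a = p \<and> b = d - 1 \<or> 1 \<le> p \<and> d < q \<and> a = p - 1 \<and> b = q - 1"
  using assms unfolding corner_def by auto

lemma corner_rect_row_bottom: "1 \<le> d \<Longrightarrow> d \<le> q \<Longrightarrow> corner (rect_row p q d) p (d - 1)"
  unfolding corner_def by auto

lemma corner_rect_row_top: "1 \<le> p \<Longrightarrow> d < q \<Longrightarrow> corner (rect_row p q d) (p - 1) (q - 1)"
  unfolding corner_def by auto

lemma ne_rect_row_bottom:
  assumes "1 \<le> d"
  shows "ne (rect_row p q d) p (d - 1) = p * (q - d)"
proof -
  have "{(i, j). (i, j) \<in> rect_row p q d \<and> i < p \<and> d - 1 < j} = {..<p} \<times> {d..<q}"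
    using assms by auto
  thus ?thesis unfolding ne_def by simp
qed

lemma sw_rect_row_bottom: "sw (rect_row p q d) p c = 0"
proof -
  have "{(i, j). (i, j) \<in> rect_row p q d \<and> p < i \<and> j < c} = {}" by auto
  thus ?thesis unfolding sw_def by (simp only: card.empty)
qed

lemma ne_rect_row_top: "1 \<le> p \<Longrightarrow> d \<le> q \<Longrightarrow> ne (rect_row p q d) (p - 1) (q - 1) = 0"
proof -
  assume "1 \<le> p" "d \<le> q"
  hence "{(i, j). (i, j) \<in> rect_row p q d \<and> i < p - 1 \<and> q - 1 < j} = {}" by auto
  thus ?thesis unfolding ne_def by (simp only: card.empty)
qed

lemma sw_rect_row_top: "1 \<le> p \<Longrightarrow> d < q \<Longrightarrow> sw (rect_row p q d) (p - 1) (q - 1) = d"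
proof -
  assume "1 \<le> p" "d < q"
  hence "{(i, j). (i, j) \<in> rect_row p q d \<and> p - 1 < i \<and> j < q - 1} = {p} \<times> {..<d}" by auto
  thus ?thesis unfolding sw_def by simp
qed

lemma reach_pred:
  assumes "reach Y r c j" "Y \<noteq> {(0, 0)}"
  obtains a b i where "reach (Y - {(r, c)}) a b i" "corner (Y - {(r, c)}) a b"
    "addable (Y - {(r, c)}) r c"
    "j = i + (if a < r then int (card (Y - {(r, c)})) else 0) - int r"
  using assms(1)
proof cases
  case single
  thus ?thesis using assms by simp
next
  case (add Y' a b i)
  hence "Y - {(r, c)} = Y'" unfolding addable_def by auto
  thus ?thesis using that[of a b i] reach_corner add by simp
qed

text \<open>
  The value next to the smallest one is never attained when the largest entry ends the short last
  row. If the previous entry also lies in the last row, then the claim is the same for a shorter last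
  row; if it lies above, then the new descent overshoots. A last row with a single cell shifts all
  values of the rectangle above it by the same amount, and the gap with them. The induction ends with
  a single row, whose only tableau has no descent. For \<open>d = q\<close> this is the gap of a rectangle.
\<close>
lemma reach_rect_row_gap:
  assumes "1 \<le> d" "d \<le> q" "reach (rect_row p q d) p (d - 1) j"
  shows "j \<noteq> int (p * (q - d)) + 1"
  using assms
proof (induction p arbitrary: d j)
  case 0
  have "offpairs (rect_row 0 q d) = 0" by (rule offpairs_eq_0) auto
  hence "j \<le> 0" using reach_le[OF 0(3)] by simp
  thus ?case by simp
next
  case (Suc p)
  note IH = Suc.IH
  show ?case using Suc.prems
  proof (induction d arbitrary: j)
    case (Suc d)
    have "(0, 0) \<in> rect_row (Suc p) q (Suc d)" "(Suc p, 0) \<in> rect_row (Suc p) q (Suc d)"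
      using Suc.prems by auto
    hence "rect_row (Suc p) q (Suc d) \<noteq> {(0, 0)}" by blast
    moreover have "rect_row (Suc p) q (Suc d) - {(Suc p, d)} = rect_row (Suc p) q d" by auto
    ultimately obtain a b i where ab: "reach (rect_row (Suc p) q d) a b i" "corner (rect_row (Suc p) q d) a b"
      and j: "j = i + (if a < Suc p then int (card (rect_row (Suc p) q d)) else 0) - int (Suc p)"
      using reach_pred[OF Suc.prems(3)] by (metis diff_Suc_1)
    show ?case
    proof (cases "d = 0")
      case True
      have "a = p" "b = q - 1"
        using corner_rect_row[of p q q a b] ab(2) Suc.prems(2) unfolding True rect_row_full by auto
      hence "i \<noteq> 1" using IH[where d = q and j = i]
          ab(1) Suc.prems(2) unfolding True rect_row_full by auto
      moreover have "int (p * q + q) - int (Suc p) = int (Suc p * (q - 1))"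
        using Suc.prems(2) by (cases q) (auto simp: algebra_simps)
      ultimately show ?thesis using j \<open>a = p\<close> unfolding True rect_row_full card_rect_row by auto
    next
      case False
      consider "a = Suc p" "b = d - 1" | "a = p"
        using corner_rect_row[OF ab(2)] False Suc.prems(2) by auto
      thus ?thesis
      proof cases
        case 1
        hence "i \<noteq> int (Suc p * (q - d)) + 1" using Suc.IH[of i] ab(1) Suc.prems False by simp
        moreover obtain e where "q = Suc d + e" using Suc.prems(2) by (metis le_Suc_ex)
        hence "int (Suc p * (q - d)) - int (Suc p) = int (Suc p * (q - Suc d))"
          by (simp add: algebra_simps)
        moreover have "j = i - int (Suc p)" using j 1 by simp
        ultimately show ?thesis by (smt (verit))
      next
        case 2
        have "0 \<le> i" using reach_ge[OF ab(1)] by linarith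
        moreover have "Suc p * (q - Suc d) + 1 + Suc p < Suc p * q + d"
        proof -
          obtain e where q: "q = Suc d + e" using Suc.prems(2) by (metis le_Suc_ex)
          obtain d' where d: "d = Suc d'" using False by (cases d) auto
          show ?thesis unfolding q d by (simp add: algebra_simps)
        qed
        hence "int (Suc p * (q - Suc d)) + 1 + int (Suc p) < int (Suc p * q + d)" by linarith
        ultimately show ?thesis using j 2 unfolding card_rect_row by simp
      qed
    qed
  qed simp
qed

section \<open>The gaps\<close>

text \<open>
  The corners at which the value next to the smallest one is missing: the last cell of the last row
  when all other rows have equal length, and the additional cell of a rectangle with one cell added to
  its first row. The second kind is the transpose of a rectangle with one cell below it, and is stated
  that way. For a single column, and for \<open>p = d = 1\<close>, there is only one tableau with its largest
  entry in the last row, and so nothing is missing.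
\<close>
definition low_gap :: "(nat \<times> nat) set \<Rightarrow> nat \<Rightarrow> nat \<Rightarrow> bool" where
  "low_gap Y r c \<longleftrightarrow>
    (\<exists>p q d. 1 \<le> p \<and> 2 \<le> q \<and> 1 \<le> d \<and> d \<le> q \<and> (p, d) \<noteq> (1, 1) \<and> Y = rect_row p q d \<and> r = p \<and> Suc c = d) \<or>
    (\<exists>p q. 2 \<le> p \<and> 2 \<le> q \<and> Y\<inverse> = rect_row q p 1 \<and> r = 0 \<and> c = q)"

definition high_gap :: "(nat \<times> nat) set \<Rightarrow> nat \<Rightarrow> nat \<Rightarrow> bool" where
  "high_gap Y r c \<longleftrightarrow> low_gap (Y\<inverse>) c r"

definition near_rect :: "(nat \<times> nat) set \<Rightarrow> bool" where
  "near_rect Y \<longleftrightarrow> (\<exists>p q d. 1 \<le> d \<and> d \<le> q \<and> (Y = rect_row p q d \<or> Y\<inverse> = rect_row p q d))"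

lemma near_rect_converse [simp]: "near_rect (Y\<inverse>) \<longleftrightarrow> near_rect Y"
  unfolding near_rect_def by (metis converse_converse)

lemma low_gap_near_rect: "low_gap Y r c \<Longrightarrow> near_rect Y"
  unfolding low_gap_def near_rect_def by (metis le_trans one_le_numeral order_refl)

lemma high_gap_near_rect: "high_gap Y r c \<Longrightarrow> near_rect Y"
  unfolding high_gap_def using low_gap_near_rect near_rect_converse by blast

lemma rect_row_eqD: "X = rect_row p q d \<Longrightarrow> (i, j) \<in> X \<longleftrightarrow> i < p \<and> j < q \<or> i = p \<and> j < d"
  by simp

text \<open>
  A shape may have several descriptions, so that the gaps at the corners of \<open>rect_row p q d\<close> have
  to be read off by comparing single cells. The next lemmas do this for both corners; the restrictions
  found here are what the arithmetic below has to deal with.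
\<close>
lemma low_gap_rect_row_top:
  assumes "1 \<le> p" "1 \<le> d" "d < q" "low_gap (rect_row p q d) (p - 1) (q - 1)"
  shows "p = 1 \<and> q = d + 1 \<and> 2 \<le> d"
  using assms(4) unfolding low_gap_def
proof (elim disjE exE conjE)
  fix p' q' d'
  assume "rect_row p q d = rect_row p' q' d'" "p - 1 = p'"
  from rect_row_eqD[OF this(1), of p 0] this(2) show ?thesis using assms by auto
next
  fix P Q
  assume a: "2 \<le> P" "2 \<le> Q" "(rect_row p q d)\<inverse> = rect_row Q P 1" "p - 1 = 0" "q - 1 = Q"
  show ?thesis using rect_row_eqD[OF a(3), of "Q - 1" 1] a(1,2,4,5) assms(1-3) by auto
qed

lemma high_gap_rect_row_top:
  assumes "1 \<le> p" "1 \<le> d" "d < q" "high_gap (rect_row p q d) (p - 1) (q - 1)"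
  shows "q = d + 1 \<and> (p, d) \<noteq> (1, 1)"
  using assms(4) unfolding high_gap_def low_gap_def
proof (elim disjE exE conjE)
  fix P Q D
  assume a: "(rect_row p q d)\<inverse> = rect_row P Q D" "q - 1 = P" "Suc (p - 1) = D" "(P, D) \<noteq> (1, 1)" "D \<le> Q"
  have "P = d"
    using rect_row_eqD[OF a(1), of d p] rect_row_eqD[OF a(1), of 0 p] a(2,3,5) assms(1-3) by auto
  thus ?thesis using a assms by auto
next
  fix P Q
  assume "q - 1 = 0"
  thus ?thesis using assms by auto
qed

lemma low_gap_rect_row_bottom:
  assumes "1 \<le> p" "1 \<le> d" "low_gap (rect_row p q d) p (d - 1)"
  shows "(p, d) \<noteq> (1, 1)"
  using assms unfolding low_gap_def by auto

lemma high_gap_rect_row_bottom: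
  assumes "1 \<le> p" "1 \<le> d" "d < q" "high_gap (rect_row p q d) p (d - 1)"
  shows "d = 1 \<and> 2 \<le> p"
  using assms(4) unfolding high_gap_def low_gap_def
proof (elim disjE exE conjE)
  fix P Q D
  assume a: "(rect_row p q d)\<inverse> = rect_row P Q D" "d - 1 = P"
  show ?thesis using rect_row_eqD[OF a(1), of d 0] a(2) assms by auto
next
  fix P Q
  assume "d - 1 = 0" "p = Q" "2 \<le> Q"
  thus ?thesis using assms by auto
qed

text \<open>
  After substituting \<open>p = P + 1\<close>, \<open>d = D + 1\<close>, \<open>q = D + 2 + e\<close> and splitting off small
  values of \<open>P\<close> and \<open>D\<close>, the claims compare polynomials with nonnegative coefficients term by
  term. The next two lemmas are obtained in the same way.
\<close>
lemma offpairs_rect_row_ge: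
  assumes "1 \<le> p" "1 \<le> d" "d < q" "(p, d) \<noteq> (1, 1)"
  shows "d + p * (q - d) + 1 \<le> offpairs (rect_row p q d)" "p * q + d \<le> offpairs (rect_row p q d) + 1"
proof -
  obtain P where p: "p = Suc P" using assms(1) by (cases p) auto
  obtain D where d: "d = Suc D" using assms(2) by (cases d) auto
  obtain e where q: "q = Suc (Suc D) + e" using assms(3) d by (metis Suc_leI le_Suc_ex)
  have W: "2 * offpairs (rect_row p q d) = p * (p - 1) * q * (q - 1) + 2 * p * d * (q - 1)"
    using assms by (intro offpairs_rect_row) auto
  have "2 * (d + p * (q - d) + 1) \<le> 2 * offpairs (rect_row p q d) \<and>
        2 * (p * q + d) \<le> 2 * (offpairs (rect_row p q d) + 1)"
  proof (cases P)
    case 0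
    then obtain D' where D: "D = Suc D'" using assms p d by (cases D) auto
    show ?thesis using W unfolding p d q D 0 by (simp add: algebra_simps)
  next
    case (Suc P')
    show ?thesis using W unfolding p d q Suc by (simp add: algebra_simps)
  qed
  thus "d + p * (q - d) + 1 \<le> offpairs (rect_row p q d)" "p * q + d \<le> offpairs (rect_row p q d) + 1"
    unfolding nat_mult_le_cancel_disj by simp_all
qed

lemma offpairs_rect_row_neq:
  assumes "1 \<le> p" "1 \<le> d" "q = d + 1" "(p, d) \<noteq> (1, 1)"
  shows "offpairs (rect_row p q d) \<noteq> d + p + 2"
proof -
  obtain P where p: "p = Suc P" using assms(1) by (cases p) auto
  obtain D where d: "d = Suc D" using assms(2) by (cases d) auto
  have W: "2 * offpairs (rect_row p q d) = p * (p - 1) * q * (q - 1) + 2 * p * d * (q - 1)"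
    using assms by (intro offpairs_rect_row) auto
  have "2 * offpairs (rect_row p q d) \<noteq> 2 * (d + p + 2)"
  proof (cases P)
    case 0
    obtain D' where D: "D = Suc D'" using assms p d 0 by (cases D) auto
    show ?thesis
    proof (cases D')
      case (Suc D'')
      show ?thesis using W unfolding assms(3) p d 0 D Suc by (simp add: algebra_simps)
    qed (use W in \<open>simp add: assms(3) p d 0 D\<close>)
  next
    case (Suc P')
    show ?thesis
    proof (cases P')
      case 0
      show ?thesis
      proof (cases D)
        case (Suc D')
        show ?thesis using W unfolding assms(3) p d \<open>P = Suc P'\<close> 0 Suc by (simp add: algebra_simps)
      qed (use W in \<open>simp add: assms(3) p d \<open>P = Suc P'\<close> 0\<close>)
    next
      case (Suc P'')
      show ?thesis using W unfolding assms(3) p d \<open>P = Suc P'\<close> Suc by (simp add: algebra_simps)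
    qed
  qed
  thus ?thesis by presburger
qed

lemma offpairs_rect_row_unit_ge:
  assumes "2 \<le> p" "2 \<le> q" "(p, q) \<noteq> (2, 2)"
  shows "p * q + 2 \<le> offpairs (rect_row p q 1)"
proof -
  obtain P where p: "p = Suc (Suc P)" using assms(1) by (metis add_2_eq_Suc le_Suc_ex)
  obtain Q where q: "q = Suc (Suc Q)" using assms(2) by (metis add_2_eq_Suc le_Suc_ex)
  have W: "2 * offpairs (rect_row p q 1) = p * (p - 1) * q * (q - 1) + 2 * p * 1 * (q - 1)"
    using assms by (intro offpairs_rect_row) auto
  have "2 * (p * q + 2) \<le> 2 * offpairs (rect_row p q 1)"
  proof (cases P)
    case 0
    then obtain Q' where Q: "Q = Suc Q'" using assms p q by (cases Q) auto
    show ?thesis using W unfolding p q Q 0 by (simp add: algebra_simps)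
  next
    case (Suc P')
    show ?thesis using W unfolding p q Suc by (simp add: algebra_simps)
  qed
  thus ?thesis unfolding nat_mult_le_cancel_disj by simp
qed

section \<open>All other values are attained\<close>

definition covered :: "(nat \<times> nat) set \<Rightarrow> nat \<Rightarrow> nat \<Rightarrow> bool" where
  "covered Y r c \<longleftrightarrow> (\<forall>j. int (ne Y r c) \<le> j \<longrightarrow> j \<le> int (offpairs Y) - int (sw Y r c) \<longrightarrow>
     \<not> (low_gap Y r c \<and> j = int (ne Y r c) + 1) \<longrightarrow>
     \<not> (high_gap Y r c \<and> j = int (offpairs Y) - int (sw Y r c) - 1) \<longrightarrow> reach Y r c j)"

definition filled :: "(nat \<times> nat) set \<Rightarrow> bool" where
  "filled Y \<longleftrightarrow> (\<forall>r c. corner Y r c \<longrightarrow> covered Y r c)"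

lemma covered_converse:
  assumes "diagram Y" "covered (Y\<inverse>) c r"
  shows "covered Y r c"
  unfolding covered_def
proof (intro allI impI)
  fix j
  assume j: "int (ne Y r c) \<le> j" "j \<le> int (offpairs Y) - int (sw Y r c)"
    "\<not> (low_gap Y r c \<and> j = int (ne Y r c) + 1)"
    "\<not> (high_gap Y r c \<and> j = int (offpairs Y) - int (sw Y r c) - 1)"
  have "reach (Y\<inverse>) c r (int (offpairs Y) - j)"
    using assms(2)[unfolded covered_def, rule_format, of "int (offpairs Y) - j"] j assms(1)
    unfolding high_gap_def by auto
  from reach_converse[OF this] show "reach Y r c j" using assms(1) by simp
qed

lemma filled_converse: "diagram Y \<Longrightarrow> filled (Y\<inverse>) \<longleftrightarrow> filled Y"
  unfolding filled_def
  by (metis converse_converse corner_converse covered_converse diagram_converse)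

lemma reach_below: "reach Y a b i \<Longrightarrow> addable Y r c \<Longrightarrow> r \<le> a \<Longrightarrow> reach (insert (r, c) Y) r c (i - int r)"
  using reach.add[of Y a b i r c] by simp

lemma reach_above:
  "reach Y a b i \<Longrightarrow> addable Y r c \<Longrightarrow> a < r \<Longrightarrow> reach (insert (r, c) Y) r c (i + int (card Y) - int r)"
  using reach.add[of Y a b i r c] by simp

text \<open>
  Only near-rectangular shapes have gaps, so any other shape attains a full interval at each corner.
\<close>
lemma reach_corner_interval:
  assumes "filled Y" "\<not> near_rect Y" "corner Y a b"
    "int (ne Y a b) \<le> j" "j \<le> int (offpairs Y) - int (sw Y a b)"
  shows "reach Y a b j"
  using assms low_gap_near_rect high_gap_near_rect unfolding filled_def covered_def by blast

lemma ex_bottom_corner: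
  assumes "diagram Y" "Y \<noteq> {}"
  obtains a b where "corner Y a b" "sw Y a b = 0" "\<And>i j. (i, j) \<in> Y \<Longrightarrow> i \<le> a"
proof -
  obtain a b where ab: "corner Y a b" "\<And>i j. (i, j) \<in> Y \<Longrightarrow> i \<le> a"
    using ex_corner_lowest[OF assms] by metis
  hence "{(i, j). (i, j) \<in> Y \<and> a < i \<and> j < b} = {}" by fastforce
  hence "sw Y a b = 0" unfolding sw_def by (simp only: card.empty)
  thus ?thesis using that ab by blast
qed

lemma ex_right_corner:
  assumes "diagram Y" "Y \<noteq> {}"
  obtains a b where "corner Y a b" "ne Y a b = 0" "\<And>i j. (i, j) \<in> Y \<Longrightarrow> j \<le> b"
proof -
  obtain b a where "corner (Y\<inverse>) b a" "sw (Y\<inverse>) b a = 0" "\<And>j i. (j, i) \<in> Y\<inverse> \<Longrightarrow> j \<le> b"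
    using ex_bottom_corner[of "Y\<inverse>"] assms by (metis converse_empty converse_inject diagram_converse)
  thus ?thesis using that[of a b] by auto
qed

text \<open>
  The bottom of the column to the left of the new cell: its interval starts where the interval of the
  new cell has to start.
\<close>
lemma ex_corner_left:
  assumes "addable Y r c" "1 \<le> c"
  obtains a where "corner Y a (c - 1)" "r \<le> a" "ne Y a (c - 1) = ne (insert (r, c) Y) r c + r"
proof -
  define R where "R = {i. (i, c - 1) \<in> Y}"
  have fin: "finite R"
    unfolding R_def by (rule finite_subset[of _ "fst ` Y"]) (use assms in \<open>force+\<close>)
  have "r \<in> R" using addable_le[OF assms(1), of r "c - 1"] assms(2) unfolding R_def by auto
  define a where "a = Max R"
  have a: "a \<in> R" "r \<le> a" "Suc a \<notin> R"
    unfolding a_def using fin \<open>r \<in> R\<close> Max_ge[OF fin]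
    by (auto intro: Max_in dest: Max_ge[OF fin])
  have "(a, c) \<notin> Y" using addable_ge[OF assms(1), of a c] a by simp
  hence "corner Y a (c - 1)" using a assms(2) unfolding corner_def R_def by simp
  moreover have "i < a \<and> c - 1 < j \<longleftrightarrow> i < r \<and> c \<le> j" if "(i, j) \<in> Y" for i j
    using addable_ge[OF assms(1), of i j] that a(2) assms(2)
    by (cases "r \<le> i"; cases "c \<le> j") auto
  hence "{(i, j). (i, j) \<in> Y \<and> i < a \<and> c - 1 < j} = {(i, j). (i, j) \<in> Y \<and> i < r \<and> c \<le> j}"
    by blast
  hence "ne Y a (c - 1) = ne (insert (r, c) Y) r c + r"
    unfolding ne_insert[OF assms(1)] unfolding ne_def by (rule arg_cong)
  ultimately show ?thesis using that a by blast
qed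

text \<open>
  The end of the row above the new cell: shifted by the new descent, its interval ends where the
  interval of the new cell has to end.
\<close>
lemma ex_corner_above:
  assumes "addable Y r c" "1 \<le> r"
  obtains b where "corner Y (r - 1) b" "c \<le> b" "sw Y (r - 1) b = sw (insert (r, c) Y) r c + c"
proof -
  have "addable (Y\<inverse>) c r" using assms by simp
  from ex_corner_left[OF this assms(2)] obtain b where
    "corner (Y\<inverse>) b (r - 1)" "c \<le> b" "ne (Y\<inverse>) b (r - 1) = ne (insert (c, r) (Y\<inverse>)) c r + c"
    by metis
  thus ?thesis using that[of b] unfolding converse_insert_pair[symmetric] by simp
qed

text \<open>
  With a first row of length \<open>a\<close> and \<open>m\<close> cells below it, each of these \<open>m\<close> cells forms a
  counted pair with \<open>a - 1\<close> cells of the first row. For \<open>a \<ge> 3\<close> and \<open>m \<ge> 2\<close> that is enough.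
\<close>
lemma card_le_offpairs_wide:
  assumes "diagram Y" "(0, 1) \<in> Y" "(1, 0) \<in> Y" "(0, 2) \<in> Y"
  shows "card Y \<le> offpairs Y + 1 \<or> near_rect Y"
proof -
  have fin: "finite Y" using assms by simp
  define C where "C = {j. (0, j) \<in> Y}"
  define R where "R = {(i, j). (i, j) \<in> Y \<and> 0 < i}"
  have finC: "finite C"
    unfolding C_def by (rule finite_subset[of _ "snd ` Y"]) (use fin in \<open>force+\<close>)
  have finR: "finite R" unfolding R_def using fin by (auto intro: finite_subset[of _ Y])
  have inC: "j \<in> C" if "(i, j) \<in> Y" for i j
    using diagramD[OF assms(1) that, of 0 j] unfolding C_def by simp
  have YCR: "Y = {0} \<times> C \<union> R" unfolding C_def R_def by (auto intro: gr0I)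
  moreover have "card ({0} \<times> C \<union> R) = card ({0::nat} \<times> C) + card R"
    using finC finR by (intro card_Un_disjoint) (auto simp: R_def)
  ultimately have N: "card Y = card C + card R" by (metis card_cartesian_product_singleton)
  have "{0, 1, 2} \<subseteq> C" using assms(1,2,4) diagramD[OF assms(1,2), of 0 0] unfolding C_def by simp
  from card_mono[OF finC this] have c3: "3 \<le> card C" by simp
  let ?S = "SIGMA y:R. C - {snd y}"
  have "card ?S = (\<Sum>y\<in>R. card (C - {snd y}))" using finR finC by simp
  also have "\<dots> = (\<Sum>y\<in>R. card C - 1)"
    using inC by (intro sum.cong refl) (auto simp: R_def finC)
  finally have "card ?S = card R * (card C - 1)" by simp
  moreover have "card ?S \<le> offpairs Y"
    unfolding offpairs_def
  proof (rule card_inj_on_le)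
    show "inj_on (\<lambda>(y, j). ((0, j), y)) ?S" by (auto simp: inj_on_def)
    show "(\<lambda>(y, j). ((0, j), y)) ` ?S \<subseteq>
      {((i, j), (i', j')). (i, j) \<in> Y \<and> (i', j') \<in> Y \<and> i < i' \<and> j \<noteq> j'}"
      unfolding R_def C_def by auto
  qed (rule finite_offpairs[OF fin])
  ultimately have W: "card R * (card C - 1) \<le> offpairs Y" by simp
  show ?thesis
  proof (cases "2 \<le> card R")
    case True
    then obtain x where x: "card R = 2 + x" by (metis le_Suc_ex)
    obtain y where y: "card C = 3 + y" using c3 by (metis le_Suc_ex)
    from W have "card Y \<le> offpairs Y + 1" unfolding N x y by (simp add: algebra_simps)
    thus ?thesis ..
  next
    case False
    moreover have "(1, 0) \<in> R" using assms unfolding R_def by simp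
    ultimately have R: "R = {(1, 0)}"
      by (metis One_nat_def card_1_singletonE card_gt_0_iff empty_iff finR le_less_Suc_eq
          less_Suc_eq_le not_less_eq_eq numeral_2_eq_2 singletonD Suc_leI)
    define m where "m = Max C"
    have "j \<in> C \<longleftrightarrow> j < Suc m" for j
    proof
      assume "j \<in> C" thus "j < Suc m" unfolding m_def using finC by (simp add: less_Suc_eq_le)
    next
      assume "j < Suc m"
      moreover have "m \<in> C" unfolding m_def using finC \<open>{0, 1, 2} \<subseteq> C\<close> by (intro Max_in) auto
      ultimately show "j \<in> C" unfolding C_def using diagramD[OF assms(1), of 0 m 0 j] by simp
    qed
    hence "Y = rect_row 1 (Suc m) 1"
      unfolding YCR R rect_row_def by auto
    thus ?thesis unfolding near_rect_def by (metis le_add1 order_refl plus_1_eq_Suc)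
  qed
qed

text \<open>
  This makes the values from corners below the new cell, which end at \<open>offpairs Y\<close>, meet the
  values from corners above it, which start at \<open>card Y\<close>.
\<close>
lemma card_le_offpairs:
  assumes "diagram Y" "(0, 1) \<in> Y" "(1, 0) \<in> Y" "\<not> near_rect Y"
  shows "card Y \<le> offpairs Y + 1"
proof -
  consider "(0, 2) \<in> Y" | "(2, 0) \<in> Y" | "(0, 2) \<notin> Y" "(2, 0) \<notin> Y" by blast
  thus ?thesis
  proof cases
    case 1
    thus ?thesis using card_le_offpairs_wide assms by blast
  next
    case 2
    thus ?thesis using card_le_offpairs_wide[of "Y\<inverse>"] assms by simp
  next
    case 3
    have "i < 2 \<and> j < 2" if "(i, j) \<in> Y" for i j
      using 3 diagramD[OF assms(1) that, of 0 2] diagramD[OF assms(1) that, of 2 0] by force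
    moreover have "(0, 0) \<in> Y" using diagramD[OF assms(1,2), of 0 0] by simp
    ultimately have "Y = rect_row 1 2 (if (1, 1) \<in> Y then 2 else 1)"
      using assms(2,3) unfolding rect_row_def by (auto simp: less_2_cases_iff split: if_splits)
    hence "near_rect Y" unfolding near_rect_def
      by (metis (mono_tags) one_le_numeral order_refl)
    thus ?thesis using assms(4) by contradiction
  qed
qed

lemma low_gap_rect_row:
  assumes "1 \<le> p" "2 \<le> q" "c < q" "(p, c) \<noteq> (1, 0)"
  shows "low_gap (rect_row p q (Suc c)) p c"
  unfolding low_gap_def
  by (intro disjI1 exI[of _ p] exI[of _ q] exI[of _ "Suc c"]) (use assms in auto)

lemma low_gap_rectangle_cell: "2 \<le> p \<Longrightarrow> 2 \<le> q \<Longrightarrow> low_gap ((rect_row q p 1)\<inverse>) 0 q"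
  unfolding low_gap_def converse_converse by blast

lemma gap_rectangle:
  assumes "1 \<le> d" "d \<le> q" "d = q \<or> p = 0"
    "low_gap (rect_row p q d) p (d - 1) \<or> high_gap (rect_row p q d) p (d - 1)"
  shows "1 \<le> p \<and> 2 \<le> d"
  using assms(4) unfolding high_gap_def low_gap_def
proof (elim disjE exE conjE)
  fix p' q' d'
  assume a: "1 \<le> p'" "2 \<le> q'" "rect_row p q d = rect_row p' q' d'" "p = p'"
  show ?thesis using rect_row_eqD[OF a(3), of 0 1] a(1,2,4) assms(3) by auto
next
  fix P Q
  assume a: "2 \<le> P" "2 \<le> Q" "(rect_row p q d)\<inverse> = rect_row Q P 1" "p = 0" "d - 1 = Q"
  show ?thesis using rect_row_eqD[OF a(3), of 0 1] a(1,2,4) by auto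
next
  fix P Q D
  assume a: "1 \<le> P" "2 \<le> Q" "(rect_row p q d)\<inverse> = rect_row P Q D" "d - 1 = P"
  show ?thesis using rect_row_eqD[OF a(3), of 0 1] a(1,2,4) by auto
next
  fix P Q
  assume a: "2 \<le> P" "2 \<le> Q" "((rect_row p q d)\<inverse>)\<inverse> = rect_row Q P 1" "d - 1 = 0" "p = Q"
  show ?thesis using rect_row_eqD[OF a(3), of 0 1] a(1,2,4,5) assms(1-3) by auto
qed

lemma reach_rect_row_top:
  assumes "filled (rect_row p q d)" "1 \<le> p" "1 \<le> d" "d < q"
    "0 \<le> j" "j \<le> int (offpairs (rect_row p q d)) - int d"
    "\<not> (p = 1 \<and> q = d + 1 \<and> 2 \<le> d \<and> j = 1)"
    "\<not> (q = d + 1 \<and> (p, d) \<noteq> (1, 1) \<and> j = int (offpairs (rect_row p q d)) - int d - 1)"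
  shows "reach (rect_row p q d) (p - 1) (q - 1) j"
proof -
  have "covered (rect_row p q d) (p - 1) (q - 1)"
    using assms(1)[unfolded filled_def, rule_format, OF corner_rect_row_top[OF assms(2,4)]] .
  note reach = this[unfolded covered_def ne_rect_row_top[OF assms(2) less_imp_le[OF assms(4)]]
      sw_rect_row_top[OF assms(2,4)], rule_format, of j]
  show ?thesis
  proof (rule reach)
    show "\<not> (low_gap (rect_row p q d) (p - 1) (q - 1) \<and> j = int 0 + 1)"
    proof
      assume "low_gap (rect_row p q d) (p - 1) (q - 1) \<and> j = int 0 + 1"
      hence "p = 1 \<and> q = d + 1 \<and> 2 \<le> d" "j = 1"
        using low_gap_rect_row_top[OF assms(2-4)] by (blast, linarith)
      thus False using assms(7) by blast
    qed
    show "\<not> (high_gap (rect_row p q d) (p - 1) (q - 1) \<and> j = int (offpairs (rect_row p q d)) - int d - 1)"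
      using assms(8) high_gap_rect_row_top[OF assms(2-4)] by blast
  qed (use assms(5,6) in auto)
qed

lemma reach_rect_row_bottom:
  assumes "filled (rect_row p q d)" "1 \<le> p" "1 \<le> d" "d < q"
    "int (p * (q - d)) \<le> j" "j \<le> int (offpairs (rect_row p q d))"
    "\<not> ((p, d) \<noteq> (1, 1) \<and> j = int (p * (q - d)) + 1)"
    "\<not> (d = 1 \<and> 2 \<le> p \<and> j = int (offpairs (rect_row p q d)) - 1)"
  shows "reach (rect_row p q d) p (d - 1) j"
proof -
  have "covered (rect_row p q d) p (d - 1)"
    using assms(1,3,4) corner_rect_row_bottom[of d q p] unfolding filled_def by simp
  note reach = this[unfolded covered_def ne_rect_row_bottom[OF assms(3)] sw_rect_row_bottom, rule_format, of j]
  show ?thesis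
  proof (rule reach)
    show "\<not> (low_gap (rect_row p q d) p (d - 1) \<and> j = int (p * (q - d)) + 1)"
      using assms(7) low_gap_rect_row_bottom[OF assms(2,3)] by blast
    show "\<not> (high_gap (rect_row p q d) p (d - 1) \<and> j = int (offpairs (rect_row p q d)) - int 0 - 1)"
      using assms(8) high_gap_rect_row_bottom[OF assms(2-4)] by auto
  qed (use assms(5,6) in auto)
qed

lemma rect_row_overlap:
  assumes "1 \<le> p" "1 \<le> d" "d < q"
  shows "p * (q - d) + d \<le> offpairs (rect_row p q d) + 1"
proof -
  have "ne (rect_row p q d) p (d - 1) + sw (rect_row p q d) (p - 1) (q - 1) \<le> offpairs (rect_row p q d) + 1"
    using assms diagram_rect_row[of d q p] by (intro ne_add_sw_le) auto
  thus ?thesis unfolding ne_rect_row_bottom[OF assms(2)] sw_rect_row_top[OF assms(1,3)] .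
qed

text \<open>
  For \<open>d = q\<close> or \<open>p = 0\<close> the shape is a rectangle, and the excluded values are the gaps of its
  only corner. Otherwise there are two corners, and the numerical facts about
  \<open>offpairs (rect_row p q d)\<close> say that no value is missing at both.
\<close>
lemma filled_rect_row_reach:
  assumes "filled (rect_row p q d)" "1 \<le> d" "d \<le> q" "0 \<le> j" "j \<le> int (offpairs (rect_row p q d))"
    "\<not> (1 \<le> p \<and> 2 \<le> d \<and> d = q \<and> (j = 1 \<or> j = int (offpairs (rect_row p q d)) - 1))"
  shows "\<exists>r c. reach (rect_row p q d) r c j"
proof (cases "d = q \<or> p = 0")
  case True
  have "covered (rect_row p q d) p (d - 1)"
    using assms(1-3) corner_rect_row_bottom unfolding filled_def by blast
  moreover have "p * (q - d) = 0" using True by auto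
  ultimately have "reach (rect_row p q d) p (d - 1) j"
    unfolding covered_def ne_rect_row_bottom[OF assms(2)] sw_rect_row_bottom
    using gap_rectangle[OF assms(2,3) True] True assms(4-) by auto
  thus ?thesis by blast
next
  case False
  let ?W = "offpairs (rect_row p q d)"
  have pdq: "1 \<le> p" "1 \<le> d" "d < q" using False assms by auto
  show ?thesis
  proof (rule ccontr)
    assume no: "\<not> ?thesis"
    define X where "X = p * (q - d)"
    have top: "j > int ?W - int d \<or> (p = 1 \<and> q = d + 1 \<and> 2 \<le> d \<and> j = 1) \<or>
      (q = d + 1 \<and> (p, d) \<noteq> (1, 1) \<and> j = int ?W - int d - 1)"
      using reach_rect_row_top[OF assms(1) pdq assms(4)] no by force
    have bot: "j < int X \<or> ((p, d) \<noteq> (1, 1) \<and> j = int X + 1) \<or> (d = 1 \<and> 2 \<le> p \<and> j = int ?W - 1)"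
      using reach_rect_row_bottom[OF assms(1) pdq _ assms(5)] no unfolding X_def by force
    have F1: "int X + int d \<le> int ?W + 1" using rect_row_overlap[OF pdq] unfolding X_def by linarith
    have n1: "int d + int X + 1 \<le> int ?W" if "(p, d) \<noteq> (1, 1)"
      using offpairs_rect_row_ge(1)[OF pdq that] unfolding X_def by linarith
    have X: "X = p" if "q = d + 1" using that unfolding X_def by simp
    have n2: "int ?W \<noteq> int d + int p + 2" if "q = d + 1" "(p, d) \<noteq> (1, 1)"
      using offpairs_rect_row_neq[OF pdq(1,2) that] by linarith
    from top show False
    proof (elim disjE conjE)
      assume "j > int ?W - int d"
      thus False using bot F1 n1 by auto
    next
      assume "p = 1" "q = d + 1" "2 \<le> d" "j = 1"
      thus False using bot X by auto
    next
      assume a: "q = d + 1" "(p, d) \<noteq> (1, 1)" "j = int ?W - int d - 1"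
      show False using bot n1[OF a(2)] n2[OF a(1,2)] X[OF a(1)] a(3) by auto
    qed
  qed
qed

text \<open>
  Forgetting the position of the largest entry: the values from all corners together fill the whole
  range, except that a rectangle keeps the gaps of its only corner. For a shape that is not
  near-rectangular, the rightmost corner supplies the smallest values and the lowest one the largest
  values.
\<close>
lemma filled_reach:
  assumes "filled Y" "diagram Y" "Y \<noteq> {}" "0 \<le> j" "j \<le> int (offpairs Y)"
    "\<And>p q. 2 \<le> p \<Longrightarrow> 2 \<le> q \<Longrightarrow> Y = {..<p} \<times> {..<q} \<Longrightarrow> j \<noteq> 1 \<and> j \<noteq> int (offpairs Y) - 1"
  shows "\<exists>r c. reach Y r c j"
proof (cases "near_rect Y")
  case True
  have rect: "rect_row p q q = {..<Suc p} \<times> {..<q}" for p q unfolding rect_row_def by auto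
  from True consider p q d where "1 \<le> d" "d \<le> q" "Y = rect_row p q d"
    | p q d where "1 \<le> d" "d \<le> q" "Y\<inverse> = rect_row p q d" unfolding near_rect_def by metis
  thus ?thesis
  proof cases
    case 1
    show ?thesis unfolding 1(3)
    proof (rule filled_rect_row_reach[OF _ 1(1,2) assms(4)])
      show "\<not> (1 \<le> p \<and> 2 \<le> d \<and> d = q \<and> (j = 1 \<or> j = int (offpairs (rect_row p q d)) - 1))"
        using assms(6)[of "Suc p" q] unfolding 1(3) by (auto simp: rect)
    qed (use assms 1 in auto)
  next
    case 2
    have W: "offpairs (rect_row p q d) = offpairs Y" using 2 assms(2) by (metis offpairs_converse)
    have "\<exists>r c. reach (rect_row p q d) r c (int (offpairs Y) - j)"
    proof (rule filled_rect_row_reach[OF _ 2(1,2)])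
      show "filled (rect_row p q d)" using assms(1,2) filled_converse 2(3) by metis
      have "Y = {..<q} \<times> {..<Suc p}" if "d = q"
        using 2(3) that rect[of p q] by (metis converse_converse converse_Times)
      thus "\<not> (1 \<le> p \<and> 2 \<le> d \<and> d = q \<and>
        (int (offpairs Y) - j = 1 \<or> int (offpairs Y) - j = int (offpairs (rect_row p q d)) - 1))"
        using assms(6)[of q "Suc p"] unfolding W by auto
    qed (use assms W in auto)
    then obtain r c where "reach (rect_row p q d) r c (int (offpairs Y) - j)" by blast
    from reach_converse[OF this] have "reach Y c r j"
      unfolding W using 2(3) by (metis converse_converse diff_diff_eq2 add_diff_cancel_left')
    thus ?thesis by blast
  qed
next
  case False
  obtain a b where A: "corner Y a b" "ne Y a b = 0" using ex_right_corner assms by metis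
  obtain a' b' where B: "corner Y a' b'" "sw Y a' b' = 0" using ex_bottom_corner assms by metis
  have "ne Y a' b' + sw Y a b \<le> offpairs Y + 1"
    using ne_add_sw_le assms(2) A B unfolding corner_def by auto
  hence "int (ne Y a b) \<le> j \<and> j \<le> int (offpairs Y) - int (sw Y a b) \<or>
      int (ne Y a' b') \<le> j \<and> j \<le> int (offpairs Y) - int (sw Y a' b')"
    using A B assms(4,5) by linarith
  thus ?thesis using reach_corner_interval[OF assms(1) False] A(1) B(1) by blast
qed

text \<open>
  A new cell in the first column lies below all other cells, so it adds the same descent to every
  tableau of \<open>Y\<close>. Its interval is the whole range of \<open>Y\<close>, shifted; the missing values of a
  rectangle become the gaps of the new corner.
\<close>
lemma covered_first_column:
  assumes "addable Y r 0" "Y \<noteq> {}" "filled Y"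
  shows "covered (insert (r, 0) Y) r 0"
  unfolding covered_def
proof (intro allI impI)
  let ?L = "insert (r, 0) Y"
  fix j
  assume j: "int (ne ?L r 0) \<le> j" "j \<le> int (offpairs ?L) - int (sw ?L r 0)"
    "\<not> (low_gap ?L r 0 \<and> j = int (ne ?L r 0) + 1)"
    "\<not> (high_gap ?L r 0 \<and> j = int (offpairs ?L) - int (sw ?L r 0) - 1)"
  have Y: "diagram Y" using assms(1) unfolding addable_def by simp
  have rows: "i < r" if "(i, k) \<in> Y" for i k using addable_ge[OF assms(1), of i k] that by force
  have "{(i, j). (i, j) \<in> Y \<and> i < r \<and> 0 \<le> j} = Y" using rows by auto
  hence ne: "ne ?L r 0 + r = card Y" using ne_insert[OF assms(1)] by simp
  have sw: "sw ?L r 0 = 0" using sw_insert[OF assms(1)] by simp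
  have W: "offpairs ?L + r = offpairs Y + card Y" using offpairs_insert[OF assms(1)] by simp
  \<comment> \<open>the value before the last step\<close>
  define i where "i = j + int r - int (card Y)"
  have "0 \<le> i" "i \<le> int (offpairs Y)" using j(1,2) ne sw W unfolding i_def by linarith+
  moreover have "i \<noteq> 1 \<and> i \<noteq> int (offpairs Y) - 1"
    if pq: "2 \<le> p" "2 \<le> q" "Y = {..<p} \<times> {..<q}" for p q
  proof -
    have "\<not> p < r" using addable_le[OF assms(1), of p 0] unfolding pq(3) by auto
    moreover have "\<not> r < p" using rows[of r 0] pq(2) unfolding pq(3) by auto
    ultimately have "r = p" by linarith
    hence L: "?L = rect_row p q 1" unfolding pq(3) rect_row_def using pq(1,2) by auto
    have "low_gap ?L r 0" unfolding L unfolding \<open>r = p\<close> using low_gap_rect_row[of p q 0] pq(1,2) by simp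
    moreover have "high_gap ?L r 0"
      unfolding L unfolding high_gap_def \<open>r = p\<close> using low_gap_rectangle_cell[OF pq(2,1)] .
    ultimately show ?thesis using j(3,4) ne sw W unfolding i_def by linarith
  qed
  ultimately obtain a b where ab: "reach Y a b i"
    using filled_reach[OF assms(3) Y assms(2)] by metis
  hence "a < r" using reach_corner rows unfolding corner_def by blast
  from reach_above[OF ab assms(1) this] show "reach ?L r 0 j" unfolding i_def by simp
qed

text \<open>
  Four corners of \<open>Y\<close> are enough. Among the corners below the new cell, the lowest one gives the
  largest values and the one in the column next to the new cell the smallest ones; among the corners
  above it, whose values are shifted by the new descent, the rightmost one gives the smallest values
  and the one in the row next to the new cell the largest ones. The intervals meet by
  \<open>ne_add_sw_le\<close> and \<open>card_le_offpairs\<close>.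
\<close>
lemma covered_generic:
  assumes "addable Y r c" "1 \<le> r" "1 \<le> c" "\<not> near_rect Y" "filled Y"
  shows "covered (insert (r, c) Y) r c"
  unfolding covered_def
proof (intro allI impI)
  let ?L = "insert (r, c) Y"
  fix j
  assume j: "int (ne ?L r c) \<le> j" "j \<le> int (offpairs ?L) - int (sw ?L r c)"
  have Y: "diagram Y" using assms(1) unfolding addable_def by simp
  have mem: "(r, c - 1) \<in> Y" "(r - 1, c) \<in> Y" "(0, 1) \<in> Y" "(1, 0) \<in> Y"
    using addable_le[OF assms(1)] assms(2,3) by auto
  obtain s where s: "corner Y s (c - 1)" "r \<le> s" "ne Y s (c - 1) = ne ?L r c + r"
    using ex_corner_left[OF assms(1,3)] .
  obtain t where t: "corner Y (r - 1) t" "c \<le> t" "sw Y (r - 1) t = sw ?L r c + c"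
    using ex_corner_above[OF assms(1,2)] .
  obtain a b where B: "corner Y a b" "sw Y a b = 0" "r \<le> a"
    using ex_bottom_corner[OF Y] mem(1) by (metis empty_iff)
  obtain a' b' where A: "corner Y a' b'" "ne Y a' b' = 0" "c \<le> b'"
    using ex_right_corner[OF Y] mem(2) by (metis empty_iff)
  have "a' < r" using corner_vs_addable[OF assms(1) A(1)] A(3) by linarith
  have in_Y: "(s, c - 1) \<in> Y" "(r - 1, t) \<in> Y" "(a, b) \<in> Y" "(a', b') \<in> Y"
    using s t A B unfolding corner_def by auto
  have W: "offpairs ?L + r + c = offpairs Y + card Y" using offpairs_insert[OF assms(1)] .
  have N: "card Y \<le> offpairs Y + 1" using card_le_offpairs[OF Y mem(3,4) assms(4)] .
  have o1: "ne Y a b + sw Y s (c - 1) \<le> offpairs Y + 1"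
    and o2: "ne Y (r - 1) t + sw Y a' b' \<le> offpairs Y + 1"
    using ne_add_sw_le[of Y] Y in_Y by auto
  \<comment> \<open>the value before the last step, up to the contribution of a new descent\<close>
  define i where "i = j + int r"
  have i: "int (ne Y s (c - 1)) \<le> i" "i \<le> int (offpairs Y) + int (card Y) - int (sw Y (r - 1) t)"
    using j s(3) t(3) W unfolding i_def by linarith+
  note I = reach_corner_interval[OF assms(5,4)]
  have below: "reach ?L r c j" if "reach Y x y i" "r \<le> x" for x y
    using reach_below[OF that(1) assms(1) that(2)] unfolding i_def by simp
  have above: "reach ?L r c j" if "reach Y x y (i - int (card Y))" "x < r" for x y
    using reach_above[OF that(1) assms(1) that(2)] unfolding i_def by simp
  consider "i \<le> int (offpairs Y) - int (sw Y s (c - 1))"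
    | "int (ne Y a b) \<le> i" "i \<le> int (offpairs Y)"
    | "int (ne Y (r - 1) t) \<le> i - int (card Y)"
    | "0 \<le> i - int (card Y)" "i - int (card Y) \<le> int (offpairs Y) - int (sw Y a' b')"
    using o1 o2 N by linarith
  thus "reach ?L r c j"
  proof cases
    case 1
    thus ?thesis using below[OF I[OF s(1)] s(2)] i by simp
  next
    case 2
    thus ?thesis using below[OF I[OF B(1)] B(3)] B(2) by simp
  next
    case 3
    thus ?thesis using above[OF I[OF t(1)]] i assms(2) by simp
  next
    case 4
    thus ?thesis using above[OF I[OF A(1)] \<open>a' < r\<close>] A(2) by simp
  qed
qed

text \<open>
  The two corners of \<open>rect_row p q d\<close> have gaps of their own. The low gap of the bottom corner and
  the high gap of the top corner are inherited by the new corner; the other gap of each corner has to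
  be filled by the other corner, except for the row lengths \<open>(2, 2, 1)\<close> and \<open>(3, 2)\<close>, where it
  coincides with an inherited one. For \<open>p = d = 1\<close> the two intervals do not meet, and the single
  value between them is the low gap of the new corner.
\<close>
lemma covered_rect_row:
  assumes "filled (rect_row p q d)" "1 \<le> p" "1 \<le> d" "d < q"
  shows "covered (rect_row p q (Suc d)) p d"
  unfolding covered_def
proof (intro allI impI)
  let ?L = "rect_row p q (Suc d)" and ?W = "int (offpairs (rect_row p q d))"
  note add = addable_rect_row[OF assms(4), of p]
  have ins: "insert (p, d) (rect_row p q d) = ?L" by (rule insert_rect_row)
  fix j
  assume j: "int (ne ?L p d) \<le> j" "j \<le> int (offpairs ?L) - int (sw ?L p d)"
    "\<not> (low_gap ?L p d \<and> j = int (ne ?L p d) + 1)"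
    "\<not> (high_gap ?L p d \<and> j = int (offpairs ?L) - int (sw ?L p d) - 1)"
  have low: "low_gap ?L p d" using assms by (intro low_gap_rect_row) auto
  have high: "high_gap ?L p d" if "q = d + 1"
  proof -
    have "(rect_row p q (Suc d))\<inverse> = rect_row d (Suc p) (Suc p)" unfolding that by auto
    thus ?thesis unfolding high_gap_def using assms by (auto intro: low_gap_rect_row)
  qed
  define i where "i = j + int p"
  define X where "X = int (p * (q - d))"
  define N where "N = int (p * q + d)"
  obtain e where e: "q - d = Suc e" "q - Suc d = e" using assms(4) by (metis Suc_diff_Suc)
  have ne: "int (ne ?L p d) = X - int p"
    using ne_rect_row_bottom[of "Suc d" p q] unfolding X_def e by simp
  have sw: "sw ?L p d = 0" by (rule sw_rect_row_bottom)
  have WL: "int (offpairs ?L) = ?W + N - int p - int d"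
    using offpairs_insert[OF add] unfolding ins card_rect_row N_def by linarith
  have i: "X \<le> i" "i \<le> ?W + N - int d" "i \<noteq> X + 1"
    "q = d + 1 \<Longrightarrow> i \<noteq> ?W + N - int d - 1"
    using j low high ne sw WL unfolding i_def by auto
  have bottom: "reach ?L p d j"
    if "i \<le> ?W" "\<not> (d = 1 \<and> 2 \<le> p \<and> i = ?W - 1)"
  proof -
    have "reach (rect_row p q d) p (d - 1) i"
      using reach_rect_row_bottom[OF assms, of i] that i unfolding X_def by blast
    from reach_below[OF this add] show ?thesis unfolding ins i_def by simp
  qed
  have top: "reach ?L p d j"
    if "N \<le> i" "\<not> (p = 1 \<and> q = d + 1 \<and> 2 \<le> d \<and> i = N + 1)"
  proof -
    have "reach (rect_row p q d) (p - 1) (q - 1) (i - N)"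
      using reach_rect_row_top[OF assms, of "i - N"] that i by force
    from reach_above[OF this add] show ?thesis
      using assms(2) unfolding ins i_def card_rect_row N_def by simp
  qed
  have W: "2 * offpairs (rect_row p q d) = p * (p - 1) * q * (q - 1) + 2 * p * d * (q - 1)"
    using assms by (intro offpairs_rect_row) auto
  show "reach ?L p d j"
  proof (cases "i \<le> ?W")
    case True
    show ?thesis
    proof (cases "d = 1 \<and> 2 \<le> p \<and> i = ?W - 1")
      case special: True
      \<comment> \<open>in the shape \<open>(2, 2, 1)\<close> the two gaps of the bottom corner are the same value\<close>
      hence "q \<noteq> 2 \<or> p \<noteq> 2"
        using W i(3) unfolding X_def by auto
      hence "p * q + 2 \<le> offpairs (rect_row p q d)"
        using offpairs_rect_row_unit_ge[of p q] special assms(4) by auto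
      hence "int (p * q + 2) \<le> ?W" unfolding of_nat_le_iff .
      hence "N \<le> i" using special unfolding N_def by simp
      thus ?thesis using top special by simp
    qed (use bottom True in blast)
  next
    case False
    have "N \<le> i"
    proof (cases "(p, d) = (1, 1)")
      case True
      hence "?W = int q - 1" using W assms(4) by auto
      thus ?thesis using False i(3) True assms(4) unfolding X_def N_def by auto
    next
      case False
      from offpairs_rect_row_ge(2)[OF assms(2-4) this] have "N \<le> ?W + 1" unfolding N_def by linarith
      thus ?thesis using \<open>\<not> i \<le> ?W\<close> by linarith
    qed
    moreover have "\<not> (p = 1 \<and> q = d + 1 \<and> 2 \<le> d \<and> i = N + 1)"
    proof
      assume a: "p = 1 \<and> q = d + 1 \<and> 2 \<le> d \<and> i = N + 1"
      hence "offpairs (rect_row p q d) = d * d" using W by auto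
      \<comment> \<open>for \<open>d \<ge> 3\<close> the bottom corner reaches as far as \<open>d * d \<ge> 2 * d + 2\<close>\<close>
      moreover have "d = 2"
      proof (rule ccontr)
        assume "d \<noteq> 2"
        then obtain e where "d = 3 + e" using a by (metis Suc_leI le_Suc_ex le_neq_implies_less numeral_2_eq_2 numeral_3_eq_3)
        thus False using False calculation a unfolding N_def by (simp add: algebra_simps)
      qed
      ultimately show False using i(4) a unfolding N_def by simp
    qed
    ultimately show ?thesis by (rule top)
  qed
qed

lemma covered_rect_row_addable:
  assumes "filled (rect_row p q d)" "1 \<le> d" "d \<le> q" "addable (rect_row p q d) r c" "1 \<le> r" "1 \<le> c"
  shows "covered (insert (r, c) (rect_row p q d)) r c"
proof -
  have "(r, c) \<notin> rect_row p q d" "(r - 1, c) \<in> rect_row p q d" "(r, c - 1) \<in> rect_row p q d"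
    using addable_le[OF assms(4)] assms(4-6) unfolding addable_def by auto
  hence "r = p" "c = d" "d < q" using assms(5,6) by auto
  thus ?thesis using covered_rect_row[OF assms(1)] assms(2,5) insert_rect_row[of p d q] by simp
qed

text \<open>
  Induction over the diagram, deleting the corner in question: a new cell in the first column or in
  the first row is special, and so is a near-rectangular rest.
\<close>
lemma diagram_filled: "diagram Y \<Longrightarrow> filled Y"
proof (induction "card Y" arbitrary: Y)
  case 0
  hence "Y = {}" by simp
  thus ?case unfolding filled_def corner_def by simp
next
  case (Suc n)
  show ?case unfolding filled_def
  proof (intro allI impI)
    fix r c
    assume rc: "corner Y r c"
    define Z where "Z = Y - {(r, c)}"
    have add: "addable Z r c" unfolding Z_def using corner_addable Suc.prems rc .
    have Y: "Y = insert (r, c) Z" unfolding Z_def using rc unfolding corner_def by auto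
    have Z: "diagram Z" "filled Z"
      using add Suc.hyps(1)[of Z] Suc.hyps(2) unfolding addable_def Y by auto
    have Z': "filled (Z\<inverse>)" using Z filled_converse by blast
    have add': "addable (Z\<inverse>) c r" using add by simp
    have conv: "covered Y r c" if "covered (insert (c, r) (Z\<inverse>)) c r"
      using covered_converse[OF Suc.prems] that unfolding Y converse_insert_pair .
    consider "Z = {}" | "Z \<noteq> {}" "c = 0" | "Z \<noteq> {}" "r = 0"
      | "1 \<le> r" "1 \<le> c" "\<not> near_rect Z" | "1 \<le> r" "1 \<le> c" "near_rect Z" by linarith
    thus "covered Y r c"
    proof cases
      case 1
      hence "(r, c) = (0, 0)" using addable_le[OF add, of 0 0] by blast
      hence "Y = {(0, 0)}" "r = 0" "c = 0" using Y 1 by auto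
      moreover have "offpairs {(0, 0)} = 0" by (rule offpairs_eq_0) auto
      moreover have "j = 0" if "int x \<le> j" "j \<le> int 0 - int y" for x y j using that by linarith
      ultimately show ?thesis unfolding covered_def using reach.single by metis
    next
      case 2
      thus ?thesis using covered_first_column add Z(2) unfolding Y by blast
    next
      case 3
      moreover have "Z\<inverse> \<noteq> {}" using 3 by auto
      ultimately show ?thesis using conv covered_first_column add' Z' by blast
    next
      case 4
      thus ?thesis using covered_generic add Z(2) unfolding Y by blast
    next
      case 5
      then consider p q d where "1 \<le> d" "d \<le> q" "Z = rect_row p q d"
        | p q d where "1 \<le> d" "d \<le> q" "Z\<inverse> = rect_row p q d" unfolding near_rect_def by metis
      thus ?thesis
      proof cases
        case 1
        thus ?thesis using covered_rect_row_addable[of p q d r c] add Z(2) 5 unfolding Y by simp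
      next
        case 2
        have "covered (insert (c, r) (Z\<inverse>)) c r"
          using covered_rect_row_addable[of p q d c r] add' Z' 5 2 by simp
        thus ?thesis by (rule conv)
      qed
    qed
  qed
qed

section \<open>Standard tableaux\<close>

text \<open>
  Standard fillings of an arbitrary set of cells, so that the shape can lose a cell without being
  turned into a list of row lengths.
\<close>
definition standard :: "(nat \<times> nat) set \<Rightarrow> (nat \<times> nat \<Rightarrow> nat) \<Rightarrow> bool" where
  "standard Y T \<longleftrightarrow> T \<in> extensional Y \<and> bij_betw T Y {1..card Y} \<and>
     (\<forall>r c c'. (r, c) \<in> Y \<and> (r, c') \<in> Y \<and> c < c' \<longrightarrow> T (r, c) < T (r, c')) \<and>
     (\<forall>r r' c. (r, c) \<in> Y \<and> (r', c) \<in> Y \<and> r < r' \<longrightarrow> T (r, c) < T (r', c))"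

definition descent_set :: "(nat \<times> nat) set \<Rightarrow> (nat \<times> nat \<Rightarrow> nat) \<Rightarrow> nat set" where
  "descent_set Y T = {i. 1 \<le> i \<and> i < card Y \<and>
     (\<exists>x\<in>Y. \<exists>y\<in>Y. T x = i \<and> T y = i + 1 \<and> fst x < fst y)}"

text \<open>
  Descents below \<open>card Y\<close> see only old cells; whether \<open>card Y\<close> itself is a descent depends on
  the rows of the last two entries.
\<close>
lemma descent_set_insert:
  assumes bij: "bij_betw T' (insert (r, c) Y) {1..Suc (card Y)}" and z: "T' (r, c) = Suc (card Y)"
    and notin: "(r, c) \<notin> Y" and fin: "finite Y"
    and eq: "\<And>x. x \<in> Y \<Longrightarrow> T x = T' x"
    and ab: "(a, b) \<in> Y" "T' (a, b) = card Y"
  shows "descent_set (insert (r, c) Y) T' = descent_set Y T \<union> (if a < r then {card Y} else {})"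
proof -
  let ?P = "\<lambda>Y T i. \<exists>x\<in>Y. \<exists>y\<in>Y. T x = i \<and> T y = i + 1 \<and> fst x < fst (y :: nat \<times> nat)"
  have inj: "inj_on T' (insert (r, c) Y)" using bij unfolding bij_betw_def by blast
  have card: "card (insert (r, c) Y) = Suc (card Y)" using notin fin by simp
  have pos: "1 \<le> card Y" using fin ab(1) by (metis One_nat_def Suc_leI card_gt_0_iff empty_iff)
  have below: "?P (insert (r, c) Y) T' i \<longleftrightarrow> ?P Y T i" if "i < card Y" for i
  proof -
    have "T' (r, c) \<noteq> i" "T' (r, c) \<noteq> i + 1" using z that by auto
    moreover have "?P Y T i \<longleftrightarrow> ?P Y T' i" using eq by (intro bex_cong refl) simp
    ultimately show ?thesis by blast
  qed
  have top: "?P (insert (r, c) Y) T' (card Y) \<longleftrightarrow> a < r"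
  proof
    assume "?P (insert (r, c) Y) T' (card Y)"
    then obtain x y where x: "x \<in> insert (r, c) Y" "y \<in> insert (r, c) Y"
      "T' x = card Y" "T' y = card Y + 1" "fst x < fst y" by blast
    have "x = (a, b)" using inj_onD[OF inj, of x "(a, b)"] ab x(1,3) by simp
    moreover have "y = (r, c)" using inj_onD[OF inj, of y "(r, c)"] z x(2,4) by simp
    ultimately show "a < r" using x(5) by simp
  next
    assume "a < r"
    thus "?P (insert (r, c) Y) T' (card Y)"
      using ab z by (intro bexI[of _ "(a, b)"] bexI[of _ "(r, c)"]) auto
  qed
  have "i \<in> descent_set (insert (r, c) Y) T' \<longleftrightarrow> i \<in> descent_set Y T \<or> i = card Y \<and> a < r" for i
  proof -
    have "i \<in> descent_set (insert (r, c) Y) T' \<longleftrightarrow>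
        1 \<le> i \<and> (i < card Y \<or> i = card Y) \<and> ?P (insert (r, c) Y) T' i"
      unfolding descent_set_def card mem_Collect_eq by (simp only: less_Suc_eq conj_assoc)
    also have "\<dots> \<longleftrightarrow> i \<in> descent_set Y T \<or> i = card Y \<and> a < r"
      unfolding descent_set_def mem_Collect_eq using below[of i] top pos by blast
    finally show ?thesis .
  qed
  thus ?thesis by auto
qed

lemma sum_descent_set_insert:
  assumes "bij_betw T' (insert (r, c) Y) {1..Suc (card Y)}" "T' (r, c) = Suc (card Y)"
    "(r, c) \<notin> Y" "finite Y" "\<And>x. x \<in> Y \<Longrightarrow> T x = T' x" "(a, b) \<in> Y" "T' (a, b) = card Y"
  shows "\<Sum> (descent_set (insert (r, c) Y) T') = \<Sum> (descent_set Y T) + (if a < r then card Y else 0)"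
proof -
  have "card Y \<notin> descent_set Y T" "finite (descent_set Y T)"
    unfolding descent_set_def by auto
  moreover note descent_set_insert[OF assms]
  ultimately show ?thesis by simp
qed

lemma reach_standard:
  "reach Y r c j \<Longrightarrow>
    \<exists>T. standard Y T \<and> T (r, c) = card Y \<and> int (\<Sum> (descent_set Y T)) = j + int (\<Sum>(i, k)\<in>Y. i)"
proof (induction rule: reach.induct)
  case single
  define T :: "nat \<times> nat \<Rightarrow> nat" where "T = (\<lambda>x. undefined)((0, 0) := 1)"
  have "standard {(0, 0)} T" unfolding standard_def extensional_def bij_betw_def T_def by auto
  moreover have "descent_set {(0, 0)} T = {}" unfolding descent_set_def by auto
  moreover have "T (0, 0) = 1" unfolding T_def by simp
  ultimately show ?case by (intro exI[of _ T]) simp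
next
  case (add Y a b j r c)
  then obtain T where T: "standard Y T" "T (a, b) = card Y"
    "int (\<Sum> (descent_set Y T)) = j + int (\<Sum>(i, k)\<in>Y. i)" by blast
  let ?L = "insert (r, c) Y"
  define T' where "T' = T((r, c) := Suc (card Y))"
  have notin: "(r, c) \<notin> Y" and fin: "finite Y" using add.hyps by (auto simp: addable_def)
  have card: "card ?L = Suc (card Y)" using notin fin by simp
  have ab: "(a, b) \<in> Y" using reach_corner[OF add.hyps(1)] unfolding corner_def by blast
  have z: "T' (r, c) = Suc (card Y)" unfolding T'_def by simp
  have eq: "T' x = T x" if "x \<noteq> (r, c)" for x unfolding T'_def using that by simp
  have old: "T' x = T x" if "x \<in> Y" for x using eq[of x] that notin by (cases "x = (r, c)") simp_all
  have ext: "T x = undefined" if "x \<notin> Y" for x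
    using T(1) that unfolding standard_def extensional_def by blast
  have bijT: "bij_betw T Y {1..card Y}" using T(1) unfolding standard_def by blast
  hence "bij_betw T' Y {1..card Y}" using old bij_betw_cong[of Y T' T] by blast
  moreover have "{1..card Y} \<union> {T' (r, c)} = {1..Suc (card Y)}" unfolding z by auto
  ultimately have bij: "bij_betw T' ?L {1..Suc (card Y)}"
    using notIn_Un_bij_betw[of "(r, c)" Y T' "{1..card Y}"] notin z by simp
  have lt: "T' x < T' (r, c)" if "x \<in> Y" for x
    using bij_betwE[OF bijT] that unfolding z old[OF that] by (simp add: less_Suc_eq_le)
  have right: "(r, k) \<notin> Y" if "c < k" for k using addable_ge[OF add.hyps(2), of r k] that by simp
  have below: "(k, c) \<notin> Y" if "r < k" for k using addable_ge[OF add.hyps(2), of k c] that by simp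
  have "standard ?L T'"
    unfolding standard_def card
  proof (intro conjI allI impI bij)
    show "T' \<in> extensional ?L" unfolding extensional_def using eq ext by auto
  next
    fix i k k'
    assume k: "(i, k) \<in> ?L \<and> (i, k') \<in> ?L \<and> k < k'"
    hence "(i, k) \<in> Y" using right[of k'] by auto
    show "T' (i, k) < T' (i, k')"
    proof (cases "(i, k') = (r, c)")
      case False
      hence "(i, k') \<in> Y" using k by blast
      thus ?thesis
        using T(1) k \<open>(i, k) \<in> Y\<close> unfolding standard_def old[OF \<open>(i, k) \<in> Y\<close>] old[OF \<open>(i, k') \<in> Y\<close>]
        by blast
    qed (use lt \<open>(i, k) \<in> Y\<close> in metis)
  next
    fix i i' k
    assume k: "(i, k) \<in> ?L \<and> (i', k) \<in> ?L \<and> i < i'"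
    hence "(i, k) \<in> Y" using below[of i'] by auto
    show "T' (i, k) < T' (i', k)"
    proof (cases "(i', k) = (r, c)")
      case False
      hence "(i', k) \<in> Y" using k by blast
      thus ?thesis
        using T(1) k \<open>(i, k) \<in> Y\<close> unfolding standard_def old[OF \<open>(i, k) \<in> Y\<close>] old[OF \<open>(i', k) \<in> Y\<close>]
        by blast
    qed (use lt \<open>(i, k) \<in> Y\<close> in metis)
  qed
  moreover have "\<Sum> (descent_set ?L T') = \<Sum> (descent_set Y T) + (if a < r then card Y else 0)"
    using T(2) old[OF ab] by (intro sum_descent_set_insert[OF bij z notin fin _ ab]) (simp_all add: old)
  hence "int (\<Sum> (descent_set ?L T')) =
      int (\<Sum> (descent_set Y T)) + (if a < r then int (card Y) else 0)" by simp
  moreover have "int (\<Sum>(i, k)\<in>?L. i) = int r + int (\<Sum>(i, k)\<in>Y. i)"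
    using notin fin by simp
  ultimately show ?case using T(3) z card by (intro exI[of _ T']) simp
qed

lemma standard_reach:
  assumes "diagram Y" "Y \<noteq> {}" "standard Y T"
  shows "\<exists>r c. T (r, c) = card Y \<and> reach Y r c (int (\<Sum> (descent_set Y T)) - int (\<Sum>(i, k)\<in>Y. i))"
  using assms
proof (induction "card Y" arbitrary: Y T)
  case 0
  thus ?case by simp
next
  case (Suc n)
  have fin: "finite Y" using Suc.prems by simp
  have bij: "bij_betw T Y {1..card Y}" using Suc.prems(3) unfolding standard_def by blast
  have "card Y \<in> T ` Y" using bij Suc.hyps(2) unfolding bij_betw_def by simp
  then obtain r c where rc: "(r, c) \<in> Y" "T (r, c) = card Y" by force
  have le: "T x \<le> card Y" if "x \<in> Y" for x using bij that unfolding bij_betw_def by force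
  have cor: "corner Y r c"
    using Suc.prems(3) rc le unfolding standard_def corner_def by (metis lessI not_le)
  define Z where "Z = Y - {(r, c)}"
  have add: "addable Z r c" unfolding Z_def using corner_addable Suc.prems(1) cor .
  have Y: "Y = insert (r, c) Z" unfolding Z_def using rc by auto
  have notin: "(r, c) \<notin> Z" and finZ: "finite Z" using add by (auto simp: addable_def)
  have card: "card Y = Suc (card Z)" unfolding Y using notin finZ by simp
  show ?case
  proof (cases "Z = {}")
    case True
    hence "(r, c) = (0, 0)" using addable_le[OF add, of 0 0] by blast
    hence Y0: "Y = {(0, 0)}" using Y True by simp
    hence "descent_set Y T = {}" unfolding descent_set_def by auto
    thus ?thesis using Y0 rc reach.single by auto
  next
    case False
    define S where "S = restrict T Z"
    have "bij_betw T Z {1..card Z}"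
    proof -
      have "bij_betw T (Y - {(r, c)}) ({1..card Y} - {T (r, c)})"
        using bij rc(1) inj_on_image_set_diff[of T Y Y "{(r, c)}"]
        unfolding bij_betw_def by (auto intro: inj_on_diff)
      thus ?thesis unfolding Z_def[symmetric] rc(2) card by (simp add: atLeastAtMostSuc_conv)
    qed
    hence "bij_betw S Z {1..card Z}" unfolding S_def by (simp add: bij_betw_def inj_on_def)
    hence S: "standard Z S"
      using Suc.prems(3) unfolding standard_def S_def Y by auto
    have "diagram Z" using add unfolding addable_def by simp
    from Suc.hyps(1)[OF _ this False S] card Suc.hyps(2) obtain a b where
      ab: "S (a, b) = card Z" "reach Z a b (int (\<Sum> (descent_set Z S)) - int (\<Sum>(i, k)\<in>Z. i))" by auto
    have abZ: "(a, b) \<in> Z" using reach_corner[OF ab(2)] unfolding corner_def by blast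
    have "\<Sum> (descent_set (insert (r, c) Z) T) =
        \<Sum> (descent_set Z S) + (if a < r then card Z else 0)"
      using bij rc(2) notin finZ ab(1) abZ card unfolding S_def Y[symmetric]
      by (intro sum_descent_set_insert[of T r c Z S a b, folded Y, unfolded S_def]) auto
    hence eq: "int (\<Sum> (descent_set Z S)) - int (\<Sum>(i, k)\<in>Z. i) + (if a < r then int (card Z) else 0) - int r
      = int (\<Sum> (descent_set Y T)) - int (\<Sum>(i, k)\<in>Y. i)"
      unfolding Y using notin finZ by auto
    from reach.add[OF ab(2) add] show ?thesis unfolding eq Y[symmetric] using rc(2) by blast
  qed
qed

section \<open>Partitions\<close>

lemma cells_Sigma: "cells la = (SIGMA r:{..<length la}. {..<la ! r})"
  unfolding cells_def by auto

lemma card_cells: "card (cells la) = sum_list la"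
  unfolding cells_Sigma by (simp add: sum_list_sum_nth atLeast0LessThan)

lemma sum_cells_fst: "(\<Sum>(i, k)\<in>cells la. i) = b_stat la"
  unfolding cells_Sigma b_stat_def by (subst sum.Sigma[symmetric]) (auto simp: mult.commute)

lemma partition_mono:
  assumes "partition_of n la" "i \<le> k" "k < length la"
  shows "la ! k \<le> la ! i"
  using assms sorted_wrt_nth_less[of "(\<ge>)" la i k] unfolding partition_of_def
  by (cases "i = k") auto

lemma diagram_cells:
  assumes "partition_of n la"
  shows "diagram (cells la)"
  unfolding diagram_def
proof (intro conjI allI impI)
  show "finite (cells la)" unfolding cells_Sigma by simp
  fix i j i' j'
  assume "(i, j) \<in> cells la" "i' \<le> i" "j' \<le> j"
  thus "(i', j') \<in> cells la"
    using partition_mono[OF assms, of i' i] unfolding cells_def by auto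
qed

text \<open>
  The parts of the conjugate partition are the columns, so the transposed diagram is summed row by
  row.
\<close>
lemma sum_cells_snd:
  assumes "partition_of n la"
  shows "(\<Sum>(i, k)\<in>cells la. k) = b_stat (conjugate la)"
proof -
  define m where "m = (case la of [] \<Rightarrow> 0 | p # _ \<Rightarrow> p)"
  have m: "la ! r \<le> m" if "r < length la" for r
    using partition_mono[OF assms, of 0 r] that unfolding m_def by (cases la) auto
  have "(cells la)\<inverse> = (SIGMA c:{..<m}. {r. r < length la \<and> c < la ! r})"
    unfolding cells_def using m by (auto intro: less_le_trans)
  moreover have "(\<Sum>(i, k)\<in>cells la. k) = (\<Sum>(k, i)\<in>(cells la)\<inverse>. k)"
    by (simp add: sum_converse[of "\<lambda>k i. k"])
  moreover have "(\<Sum>(k, i)\<in>(SIGMA c:{..<m}. {r. r < length la \<and> c < la ! r}). k) =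
      (\<Sum>c<m. c * card {r. r < length la \<and> c < la ! r})"
    by (subst sum.Sigma[symmetric]) (auto simp: mult.commute)
  moreover have "b_stat (conjugate la) = (\<Sum>c<m. c * card {r. r < length la \<and> c < la ! r})"
    unfolding b_stat_def conjugate_def m_def[symmetric] by simp
  ultimately show ?thesis by simp
qed

lemma cells_replicate: "cells (replicate p q) = {..<p} \<times> {..<q}"
  unfolding cells_def by auto

lemma cells_rectangle:
  assumes "partition_of n la" "cells la = {..<p} \<times> {..<q}" "1 \<le> q"
  shows "la = replicate p q"
proof -
  have mem: "i < length la \<and> j < la ! i \<longleftrightarrow> i < p \<and> j < q" for i j
    using assms(2) unfolding cells_def by (auto simp: set_eq_iff)
  have pos: "0 < la ! i" if "i < length la" for i
    using assms(1) that unfolding partition_of_def by (metis gr0I nth_mem)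
  have "i < length la \<longleftrightarrow> i < p" for i using mem[of i 0] pos[of i] assms(3) by auto
  hence len: "length la = p" by (metis linorder_neqE_nat less_irrefl)
  moreover have "la ! i = q" if "i < p" for i
    using mem[of i] that len by (metis linorder_neqE_nat less_irrefl)
  ultimately show ?thesis by (intro nth_equalityI) auto
qed

lemma maj_count_pos_iff:
  assumes "1 \<le> n" "partition_of n la"
  shows "maj_count la k > 0 \<longleftrightarrow> (\<exists>r c. reach (cells la) r c (k - int (b_stat la)))"
proof -
  have SYT: "SYT la = {T. standard (cells la) T}"
    unfolding SYT_def standard_def card_cells by simp
  have maj: "maj la T = \<Sum> (descent_set (cells la) T)" for T
    unfolding maj_def descents_def descent_set_def card_cells
    by (intro arg_cong[of _ _ Sum] Collect_cong) force
  have fin: "finite (cells la)" using diagram_cells[OF assms(2)] by simp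
  have "cells la \<noteq> {}"
    using assms card_cells[of la] unfolding partition_of_def by (metis card.empty not_one_le_zero)
  have "finite (SYT la)"
  proof (rule finite_subset)
    show "SYT la \<subseteq> (\<Pi>\<^sub>E x\<in>cells la. {1..sum_list la})"
      unfolding SYT_def PiE_def bij_betw_def by auto
  qed (use fin in \<open>simp add: finite_PiE\<close>)
  hence "maj_count la k > 0 \<longleftrightarrow> (\<exists>T. standard (cells la) T \<and> int (maj la T) = k)"
    unfolding maj_count_def card_gt_0_iff SYT by auto
  also have "\<dots> \<longleftrightarrow> (\<exists>r c. reach (cells la) r c (k - int (b_stat la)))"
  proof
    assume "\<exists>T. standard (cells la) T \<and> int (maj la T) = k"
    then obtain T where "standard (cells la) T" "int (maj la T) = k" by blast
    with standard_reach[OF diagram_cells[OF assms(2)] \<open>cells la \<noteq> {}\<close>, of T]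
    show "\<exists>r c. reach (cells la) r c (k - int (b_stat la))"
      unfolding maj sum_cells_fst by auto
  next
    assume "\<exists>r c. reach (cells la) r c (k - int (b_stat la))"
    then obtain r c where "reach (cells la) r c (k - int (b_stat la))" by blast
    from reach_standard[OF this] show "\<exists>T. standard (cells la) T \<and> int (maj la T) = k"
      unfolding maj sum_cells_fst by auto
  qed
  finally show ?thesis .
qed

text \<open>
  A rectangle has one corner, and is the case \<open>d = q\<close> of \<open>reach_rect_row_gap\<close>.
\<close>
lemma reach_rectangle_gap:
  assumes "2 \<le> p" "2 \<le> q" "reach ({..<p} \<times> {..<q}) r c j"
  shows "j \<noteq> 1"
proof -
  have R: "{..<p} \<times> {..<q} = rect_row (p - 1) q q" unfolding rect_row_def using assms(1) by auto
  have "r = p - 1 \<and> c = q - 1"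
    using reach_corner[OF assms(3)] corner_rect_row[of "p - 1" q q r c] assms(2) unfolding R by auto
  hence "reach (rect_row (p - 1) q q) (p - 1) (q - 1) j" using assms(3) unfolding R by simp
  from reach_rect_row_gap[OF _ _ this] show ?thesis using assms(2) by simp
qed

theorem theorem2p1:
  fixes n :: nat and la :: "nat list" and k :: int
  assumes "1 \<le> n" and "partition_of n la"
  defines "lo \<equiv> int (b_stat la)"
    and "hi \<equiv> int (n choose 2) - int (b_stat (conjugate la))"
  defines "exceptional \<equiv> proper_rectangle la \<and> (k = lo + 1 \<or> k = hi - 1)"
  shows "(lo \<le> k \<and> k \<le> hi \<and> \<not> exceptional \<longrightarrow> maj_count la k > 0) \<and>
         (exceptional \<longrightarrow> maj_count la k = 0) \<and>
         (k < lo \<or> k > hi \<longrightarrow> maj_count la k = 0)"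
proof -
  let ?Y = "cells la"
  have Y: "diagram ?Y" using assms(2) by (rule diagram_cells)
  have card: "card ?Y = n" using assms(2) unfolding card_cells partition_of_def by simp
  have "?Y \<noteq> {}" using card assms(1) by auto
  have hi: "hi = lo + int (offpairs ?Y)"
    using choose_two_eq[OF Y] unfolding card hi_def lo_def sum_cells_fst sum_cells_snd[OF assms(2)]
    by simp
  note iff = maj_count_pos_iff[OF assms(1,2), of k, folded lo_def]
  have 1: "maj_count la k > 0" if k: "lo \<le> k" "k \<le> hi" "\<not> exceptional"
    unfolding iff
  proof (rule filled_reach[OF diagram_filled[OF Y] Y \<open>?Y \<noteq> {}\<close>])
    fix p q :: nat
    assume "2 \<le> p" "2 \<le> q" "?Y = {..<p} \<times> {..<q}"
    hence "proper_rectangle la"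
      using cells_rectangle[OF assms(2)] unfolding proper_rectangle_def by auto
    thus "k - lo \<noteq> 1 \<and> k - lo \<noteq> int (offpairs ?Y) - 1"
      using k(3) unfolding exceptional_def hi by auto
  qed (use k hi in auto)
  have 2: "maj_count la k = 0" if ex: exceptional
  proof -
    obtain p q where pq: "2 \<le> p" "2 \<le> q" "?Y = {..<p} \<times> {..<q}"
      using ex unfolding exceptional_def proper_rectangle_def by (metis cells_replicate)
    have "\<not> reach ?Y r c (k - lo)" for r c
    proof
      assume rc: "reach ?Y r c (k - lo)"
      have "k - lo \<noteq> 1" using reach_rectangle_gap[OF pq(1,2)] rc unfolding pq(3) by blast
      moreover have "int (offpairs ?Y) - (k - lo) \<noteq> 1"
        using reach_rectangle_gap[OF pq(2,1)] reach_converse[OF rc] unfolding pq(3) converse_Times by blast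
      ultimately show False using ex unfolding exceptional_def hi by linarith
    qed
    thus ?thesis using iff by blast
  qed
  have 3: "maj_count la k = 0" if "k < lo \<or> k > hi"
  proof -
    have "\<not> reach ?Y r c (k - lo)" for r c
      using reach_ge[of ?Y r c "k - lo"] reach_le[of ?Y r c "k - lo"] that hi by force
    thus ?thesis using iff by blast
  qed
  show ?thesis using 1 2 3 by blast
qed

end
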